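(* Let $V$ be a valuation ring. Then the Hermite ring conjecture holds for $V$: the polynomial ring $V[x]$ in one variable is a Hermite ring.
   Context: All rings are commutative with unity. A valuation ring is a commutative ring $V$ whose principal ideals are totally ordered by inclusion, i.e. for any $a,b\in V$ either $a\mid b$ or $b\mid a$ (zero divisors are allowed; $V$ need not be a domain). A ring $R$ is called a Hermite ring if every finitely generated stably free $R$-module is free; equivalently, every unimodular row over $R$ (a row $(c_1,\dots,c_n)\in R^{1\times n}$ whose entries generate the unit ideal) can be completed to an invertible square matrix over $R$. The Hermite ring conjecture states: if $R$ is a Hermite ring, then $R[x]$ is a Hermite ring. (It is well known that valuation rings are Hermite.) *)

theory Defs
  imports "HOL-Algebra.UnivPoly" "HOL-Algebra.Ring_Divisibility"
begin

text \<open>Zero divisors and the zero ring are allowed.\<close>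

definition valuation_ring :: "('a, 'k) ring_scheme \<Rightarrow> bool" where
  "valuation_ring V \<longleftrightarrow>
     cring V \<and>
     (\<forall>a\<in>carrier V. \<forall>b\<in>carrier V.
        PIdl\<^bsub>V\<^esub> a \<subseteq> PIdl\<^bsub>V\<^esub> b \<or> PIdl\<^bsub>V\<^esub> b \<subseteq> PIdl\<^bsub>V\<^esub> a)"

lemma valuation_ring_iff_divides:
  "valuation_ring V \<longleftrightarrow>
     cring V \<and> (\<forall>a\<in>carrier V. \<forall>b\<in>carrier V. a divides\<^bsub>V\<^esub> b \<or> b divides\<^bsub>V\<^esub> a)"
  unfolding valuation_ring_def
  by (metis cring.cgenideal_eq_genideal cring.to_contain_is_to_divide)

text \<open>
  The record type of modules extends that of rings, but the module axioms do not refer to the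
  ring multiplication and unit of the module; these two fields are left undefined below.
\<close>

definition free_mod :: "('r, 'k) ring_scheme \<Rightarrow> nat \<Rightarrow> ('r, nat \<Rightarrow> 'r) module" where
  "free_mod R n =
     \<lparr>carrier = {..<n} \<rightarrow>\<^sub>E carrier R,
      mult = undefined,
      one = undefined,
      zero = (\<lambda>i\<in>{..<n}. \<zero>\<^bsub>R\<^esub>),
      add = (\<lambda>u v. \<lambda>i\<in>{..<n}. u i \<oplus>\<^bsub>R\<^esub> v i),
      smult = (\<lambda>a u. \<lambda>i\<in>{..<n}. a \<otimes>\<^bsub>R\<^esub> u i)\<rparr>"

definition direct_sum ::
    "('r, 'm, 'k) module_scheme \<Rightarrow> ('r, 'n, 'l) module_scheme \<Rightarrow> ('r, 'm \<times> 'n) module" where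
  "direct_sum M N =
     \<lparr>carrier = carrier M \<times> carrier N,
      mult = undefined,
      one = undefined,
      zero = (\<zero>\<^bsub>M\<^esub>, \<zero>\<^bsub>N\<^esub>),
      add = (\<lambda>x y. (fst x \<oplus>\<^bsub>M\<^esub> fst y, snd x \<oplus>\<^bsub>N\<^esub> snd y)),
      smult = (\<lambda>a x. (a \<odot>\<^bsub>M\<^esub> fst x, a \<odot>\<^bsub>N\<^esub> snd x))\<rparr>"

lemma module_free_mod:
  assumes "cring R"
  shows "module R (free_mod R n)"
proof -
  interpret R: cring R by fact
  show ?thesis
  proof (rule moduleI[OF assms])
    show "abelian_group (free_mod R n)"
    proof (rule abelian_groupI)
      fix x assume x: "x \<in> carrier (free_mod R n)"
      let ?y = "\<lambda>i\<in>{..<n}. \<ominus>\<^bsub>R\<^esub> x i"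
      have "?y \<in> carrier (free_mod R n)" "?y \<oplus>\<^bsub>free_mod R n\<^esub> x = \<zero>\<^bsub>free_mod R n\<^esub>"
        using x by (auto simp: free_mod_def PiE_def Pi_def R.l_neg intro!: restrict_ext)
      then show "\<exists>y\<in>carrier (free_mod R n). y \<oplus>\<^bsub>free_mod R n\<^esub> x = \<zero>\<^bsub>free_mod R n\<^esub>"
        by blast
    qed (auto simp: free_mod_def PiE_def Pi_def extensional_def fun_eq_iff
           R.add.m_ac restrict_def)
  qed (auto simp: free_mod_def PiE_def Pi_def extensional_def fun_eq_iff
         R.l_distr R.r_distr R.m_assoc restrict_def)
qed

lemma module_direct_sum:
  assumes "module R M" and "module R N"
  shows "module R (direct_sum M N)"
proof -
  interpret M: module R M by fact
  interpret N: module R N by fact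
  show ?thesis
  proof (rule moduleI)
    show "cring R" ..
    show "abelian_group (direct_sum M N)"
    proof (rule abelian_groupI)
      fix x assume x: "x \<in> carrier (direct_sum M N)"
      let ?y = "(\<ominus>\<^bsub>M\<^esub> fst x, \<ominus>\<^bsub>N\<^esub> snd x)"
      have "?y \<in> carrier (direct_sum M N)" "?y \<oplus>\<^bsub>direct_sum M N\<^esub> x = \<zero>\<^bsub>direct_sum M N\<^esub>"
        using x by (auto simp: direct_sum_def M.M.l_neg N.M.l_neg)
      then show "\<exists>y\<in>carrier (direct_sum M N). y \<oplus>\<^bsub>direct_sum M N\<^esub> x = \<zero>\<^bsub>direct_sum M N\<^esub>"
        by blast
    qed (auto simp: direct_sum_def M.M.add.m_ac N.M.add.m_ac)
  qed (auto simp: direct_sum_def M.smult_l_distr N.smult_l_distr M.smult_r_distr N.smult_r_distr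
         M.smult_assoc1 N.smult_assoc1)
qed

definition module_iso ::
    "('r, 'k) ring_scheme \<Rightarrow> ('r, 'm, 'l) module_scheme \<Rightarrow> ('r, 'n, 'o) module_scheme
      \<Rightarrow> ('m \<Rightarrow> 'n) set" where
  "module_iso R M N =
     {f. bij_betw f (carrier M) (carrier N) \<and>
         (\<forall>x\<in>carrier M. \<forall>y\<in>carrier M. f (x \<oplus>\<^bsub>M\<^esub> y) = f x \<oplus>\<^bsub>N\<^esub> f y) \<and>
         (\<forall>a\<in>carrier R. \<forall>x\<in>carrier M. f (a \<odot>\<^bsub>M\<^esub> x) = a \<odot>\<^bsub>N\<^esub> f x)}"

definition finitely_generated :: "('r, 'k) ring_scheme \<Rightarrow> ('r, 'm, 'l) module_scheme \<Rightarrow> bool" where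
  "finitely_generated R M \<longleftrightarrow>
     (\<exists>S. finite S \<and> S \<subseteq> carrier M \<and> (\<forall>H. submodule H R M \<and> S \<subseteq> H \<longrightarrow> H = carrier M))"

definition is_basis ::
    "('r, 'k) ring_scheme \<Rightarrow> ('r, 'm, 'l) module_scheme \<Rightarrow> 'm set \<Rightarrow> bool" where
  "is_basis R M B \<longleftrightarrow>
     B \<subseteq> carrier M \<and>
     (\<forall>x\<in>carrier M. \<exists>!c. c \<in> B \<rightarrow>\<^sub>E carrier R \<and> finite {b\<in>B. c b \<noteq> \<zero>\<^bsub>R\<^esub>} \<and>
        x = (\<Oplus>\<^bsub>M\<^esub>b\<in>{b\<in>B. c b \<noteq> \<zero>\<^bsub>R\<^esub>}. c b \<odot>\<^bsub>M\<^esub> b))"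

definition is_free :: "('r, 'k) ring_scheme \<Rightarrow> ('r, 'm, 'l) module_scheme \<Rightarrow> bool" where
  "is_free R M \<longleftrightarrow> (\<exists>B. is_basis R M B)"

definition stably_free :: "('r, 'k) ring_scheme \<Rightarrow> ('r, 'm, 'l) module_scheme \<Rightarrow> bool" where
  "stably_free R M \<longleftrightarrow>
     (\<exists>m n. module_iso R (direct_sum M (free_mod R m)) (free_mod R n) \<noteq> {})"

text \<open>
  A definition in HOL cannot quantify over all types of module elements, so that type is a
  parameter of the predicate; the Hermite property is the statement for every type
  \<open>'m\<close>.  A stably free module embeds into some \<open>R\<^sup>n\<close>,
  so up to isomorphism all of them already occur for the type \<open>nat \<Rightarrow> 'r\<close>.
\<close>

definition hermite_ring :: "'m itself \<Rightarrow> ('r, 'k) ring_scheme \<Rightarrow> bool" where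
  "hermite_ring (_ :: 'm itself) R \<longleftrightarrow>
     cring R \<and>
     (\<forall>M :: ('r, 'm) module.
        module R M \<and> finitely_generated R M \<and> stably_free R M \<longrightarrow> is_free R M)"

end

theory Submission
  imports Defs
begin

text \<open>
  Let \<open>V\<close> be a valuation ring with maximal ideal \<open>m\<close>, possibly with zero divisors; only the zero
  ring, over which everything is trivial, has no such ideal.  The proof produces, from a unimodular
  row of length at least three over \<open>V[x]\<close>, a row with two comaximal entries, using elementary
  operations only.  A further operation then turns a third entry into \<open>1\<close>, and the kernel of a row
  with a unit entry is visibly free.  Rows of length at most two have a free kernel over every
  commutative ring.  A complement of a free module in a free module is free once all such kernels
  are, because a free summand can be split off one coordinate at a time
  (\<open>free_complement_cancel\<close>).

  Division with remainder over the residue field \<open>V/m\<close> brings the row to the shape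
  \<open>(f, b, \<dots>)\<close>, where \<open>f\<close> is a unit constant modulo \<open>m\<close> and the other entries vanish
  modulo \<open>m\<close>.  Collecting the other entries in one, let \<open>f\<close>, \<open>b\<close>, \<open>h\<close> generate the unit
  ideal.  The heart of the proof is that \<open>f + t h\<close> and \<open>b + w f\<close> are comaximal for suitable
  \<open>t\<close> and \<open>w\<close> (\<open>stable_range\<close>).

  As divisibility in \<open>V\<close> is total, there is \<open>a \<in> m\<close> with \<open>f \<equiv> u\<close> modulo \<open>a\<close> for a unit
  \<open>u\<close> of \<open>V\<close>.  The choice \<open>w = (a - b)/u\<close> gives \<open>b + w f = a g\<close> with \<open>g \<equiv> 1\<close> modulo \<open>m\<close>.
  If some power of \<open>a\<close> lies in the ideal \<open>(f - t h, g)\<close> and \<open>a\<close> divides \<open>t\<close>, the next power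
  lies in \<open>(f - t h, a g)\<close>; but \<open>f - t h \<equiv> u\<close> is a unit modulo every power of \<open>a\<close>, so the
  latter ideal contains \<open>1\<close>.

  It remains to find \<open>t\<close>.  Let \<open>d\<close> be the degree of \<open>g\<close>.  The \<open>d + 1\<close> polynomials
  \<open>f^i h^(d-i)\<close> are linearly dependent modulo \<open>g\<close>.  Gaussian elimination over \<open>V\<close>, together with
  Gauss's lemma for \<open>g\<close>, whose constant coefficient is a unit, yields a relation \<open>\<Sum> c_i f^i h^(d-i) \<in> (g)\<close>
  in which some \<open>c_i\<close> is a unit (\<open>exists_relation_mod\<close>).  Modulo \<open>(f - t h, g)\<close> one has
  \<open>f \<equiv> t h\<close> and \<open>h\<close> is invertible, hence \<open>\<Sum> c_i t^i\<close> lies in that ideal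
  (\<open>ideal_dehomogenize\<close>).  For a suitable power \<open>t\<close> of \<open>a\<close> this element of \<open>V\<close> divides a
  power of \<open>a\<close> (\<open>exists_power_value_divides_power\<close>).
\<close>

section \<open>Elementary operations on rows\<close>

definition row_pairing :: "('r, 'k) ring_scheme \<Rightarrow> nat \<Rightarrow> (nat \<Rightarrow> 'r) \<Rightarrow> (nat \<Rightarrow> 'r) \<Rightarrow> 'r" where
  "row_pairing R n f v = (\<Oplus>\<^bsub>R\<^esub>i\<in>{..<n}. f i \<otimes>\<^bsub>R\<^esub> v i)"

definition row_kernel :: "('r, 'k) ring_scheme \<Rightarrow> nat \<Rightarrow> (nat \<Rightarrow> 'r) \<Rightarrow> ('r, nat \<Rightarrow> 'r) module" where
  "row_kernel R n f =
     (free_mod R n)\<lparr>carrier := {v \<in> carrier (free_mod R n). row_pairing R n f v = \<zero>\<^bsub>R\<^esub>}\<rparr>"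

text \<open>Finite rank is part of the notion: it keeps the induction that splits off coordinates within
  the modules \<open>R\<^sup>k\<close>.\<close>

definition has_free_kernel :: "('r, 'k) ring_scheme \<Rightarrow> nat \<Rightarrow> (nat \<Rightarrow> 'r) \<Rightarrow> bool" where
  "has_free_kernel R n f \<longleftrightarrow> (\<exists>k. module_iso R (free_mod R k) (row_kernel R n f) \<noteq> {})"

definition unimodular_row :: "('r, 'k) ring_scheme \<Rightarrow> nat \<Rightarrow> (nat \<Rightarrow> 'r) \<Rightarrow> bool" where
  "unimodular_row R n f \<longleftrightarrow>
     f \<in> {..<n} \<rightarrow> carrier R \<and> (\<exists>g\<in>carrier (free_mod R n). row_pairing R n f g = \<one>\<^bsub>R\<^esub>)"

text \<open>The elementary automorphism \<open>shear\<close> of column vectors and its transpose \<open>shear_row\<close>, which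
  adds multiples of all other entries of a row to the entry \<open>i\<close>.\<close>

definition shear :: "('r, 'k) ring_scheme \<Rightarrow> nat \<Rightarrow> nat \<Rightarrow> (nat \<Rightarrow> 'r) \<Rightarrow> (nat \<Rightarrow> 'r) \<Rightarrow> nat \<Rightarrow> 'r" where
  "shear R n i c v = (\<lambda>j\<in>{..<n}. if j = i then v i else v j \<oplus>\<^bsub>R\<^esub> c j \<otimes>\<^bsub>R\<^esub> v i)"

definition shear_row ::
    "('r, 'k) ring_scheme \<Rightarrow> nat \<Rightarrow> nat \<Rightarrow> (nat \<Rightarrow> 'r) \<Rightarrow> (nat \<Rightarrow> 'r) \<Rightarrow> nat \<Rightarrow> 'r" where
  "shear_row R n i c f = f(i := f i \<oplus>\<^bsub>R\<^esub> (\<Oplus>\<^bsub>R\<^esub>j\<in>{..<n} - {i}. c j \<otimes>\<^bsub>R\<^esub> f j))"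

lemma carrier_free_mod: "carrier (free_mod R n) = {..<n} \<rightarrow>\<^sub>E carrier R"
  and add_free_mod: "u \<oplus>\<^bsub>free_mod R n\<^esub> v = (\<lambda>i\<in>{..<n}. u i \<oplus>\<^bsub>R\<^esub> v i)"
  and smult_free_mod: "a \<odot>\<^bsub>free_mod R n\<^esub> v = (\<lambda>i\<in>{..<n}. a \<otimes>\<^bsub>R\<^esub> v i)"
  and zero_free_mod: "\<zero>\<^bsub>free_mod R n\<^esub> = (\<lambda>i\<in>{..<n}. \<zero>\<^bsub>R\<^esub>)"
  by (simp_all add: free_mod_def)

lemma free_mod_eqI:
  assumes "u \<in> carrier (free_mod R n)" "v \<in> carrier (free_mod R n)" "\<And>i. i < n \<Longrightarrow> u i = v i"
  shows "u = v"
  using assms by (auto simp: carrier_free_mod intro: PiE_ext)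

lemma restrict_in_free_mod:
  "(\<And>i. i < n \<Longrightarrow> f i \<in> carrier R) \<Longrightarrow> (\<lambda>i\<in>{..<n}. f i) \<in> carrier (free_mod R n)"
  by (auto simp: carrier_free_mod)

lemma free_mod_memD: "v \<in> carrier (free_mod R n) \<Longrightarrow> i < n \<Longrightarrow> v i \<in> carrier R"
  by (auto simp: carrier_free_mod)

lemma row_kernel_simps:
  "carrier (row_kernel R n f) = {v \<in> carrier (free_mod R n). row_pairing R n f v = \<zero>\<^bsub>R\<^esub>}"
  "add (row_kernel R n f) = add (free_mod R n)"
  "smult (row_kernel R n f) = smult (free_mod R n)"
  by (simp_all add: row_kernel_def)

lemma module_isoI:
  assumes "bij_betw f (carrier M) (carrier N)"
    and "\<And>x y. x \<in> carrier M \<Longrightarrow> y \<in> carrier M \<Longrightarrow> f (x \<oplus>\<^bsub>M\<^esub> y) = f x \<oplus>\<^bsub>N\<^esub> f y"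
    and "\<And>a x. a \<in> carrier R \<Longrightarrow> x \<in> carrier M \<Longrightarrow> f (a \<odot>\<^bsub>M\<^esub> x) = a \<odot>\<^bsub>N\<^esub> f x"
  shows "f \<in> module_iso R M N"
  using assms by (auto simp: module_iso_def)

lemma module_iso_comp:
  assumes "f \<in> module_iso R M N" "g \<in> module_iso R N L"
  shows "g \<circ> f \<in> module_iso R M L"
proof (rule module_isoI)
  have "f x \<in> carrier N" if "x \<in> carrier M" for x
    using that assms by (auto simp: module_iso_def dest: bij_betwE)
  then show "(g \<circ> f) (x \<oplus>\<^bsub>M\<^esub> y) = (g \<circ> f) x \<oplus>\<^bsub>L\<^esub> (g \<circ> f) y"
      "a \<in> carrier R \<Longrightarrow> (g \<circ> f) (a \<odot>\<^bsub>M\<^esub> x) = a \<odot>\<^bsub>L\<^esub> (g \<circ> f) x"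
    if "x \<in> carrier M" "y \<in> carrier M" for x y a
    using that assms by (simp_all add: module_iso_def)
  show "bij_betw (g \<circ> f) (carrier M) (carrier L)"
    using assms by (auto simp: module_iso_def intro: bij_betw_trans)
qed

lemma module_iso_inv:
  assumes "module R M" "f \<in> module_iso R M N"
  shows "inv_into (carrier M) f \<in> module_iso R N M"
proof -
  interpret M: module R M by fact
  let ?g = "inv_into (carrier M) f"
  have bij: "bij_betw f (carrier M) (carrier N)"
    and add: "\<And>x y. x \<in> carrier M \<Longrightarrow> y \<in> carrier M \<Longrightarrow> f (x \<oplus>\<^bsub>M\<^esub> y) = f x \<oplus>\<^bsub>N\<^esub> f y"
    and smult: "\<And>a x. a \<in> carrier R \<Longrightarrow> x \<in> carrier M \<Longrightarrow> f (a \<odot>\<^bsub>M\<^esub> x) = a \<odot>\<^bsub>N\<^esub> f x"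
    using assms(2) by (auto simp: module_iso_def)
  have gc: "?g y \<in> carrier M" and fg: "f (?g y) = y" if "y \<in> carrier N" for y
    using that bij by (auto simp: bij_betw_def inv_into_into f_inv_into_f)
  have gf: "?g (f x) = x" if "x \<in> carrier M" for x
    using that bij by (auto simp: bij_betw_def)
  show ?thesis
  proof (rule module_isoI)
    show "bij_betw ?g (carrier N) (carrier M)" using bij by (rule bij_betw_inv_into)
    show "?g (x \<oplus>\<^bsub>N\<^esub> y) = ?g x \<oplus>\<^bsub>M\<^esub> ?g y" if "x \<in> carrier N" "y \<in> carrier N" for x y
      using gf[of "?g x \<oplus>\<^bsub>M\<^esub> ?g y"] add[of "?g x" "?g y"] gc fg that by simp
    show "?g (a \<odot>\<^bsub>N\<^esub> x) = a \<odot>\<^bsub>M\<^esub> ?g x" if "a \<in> carrier R" "x \<in> carrier N" for a x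
      using gf[of "a \<odot>\<^bsub>M\<^esub> ?g x"] smult[of a "?g x"] gc fg that by simp
  qed
qed

context cring
begin

lemma row_pairing_closed:
  assumes "f \<in> {..<n} \<rightarrow> carrier R" "v \<in> {..<n} \<rightarrow> carrier R"
  shows "row_pairing R n f v \<in> carrier R"
  unfolding row_pairing_def using assms by (intro finsum_closed) auto

lemma row_pairing_add:
  assumes "f \<in> {..<n} \<rightarrow> carrier R" "u \<in> carrier (free_mod R n)" "v \<in> carrier (free_mod R n)"
  shows "row_pairing R n f (u \<oplus>\<^bsub>free_mod R n\<^esub> v) = row_pairing R n f u \<oplus> row_pairing R n f v"
proof -
  have c: "f i \<in> carrier R" "u i \<in> carrier R" "v i \<in> carrier R" if "i < n" for i
    using assms that by (auto dest: free_mod_memD)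
  have "row_pairing R n f (u \<oplus>\<^bsub>free_mod R n\<^esub> v) = (\<Oplus>i\<in>{..<n}. f i \<otimes> u i \<oplus> f i \<otimes> v i)"
    unfolding row_pairing_def by (rule finsum_cong') (use c in \<open>auto simp: add_free_mod r_distr\<close>)
  also have "\<dots> = row_pairing R n f u \<oplus> row_pairing R n f v"
    unfolding row_pairing_def by (rule finsum_addf) (use c in auto)
  finally show ?thesis .
qed

lemma row_pairing_smult:
  assumes "f \<in> {..<n} \<rightarrow> carrier R" "a \<in> carrier R" "v \<in> carrier (free_mod R n)"
  shows "row_pairing R n f (a \<odot>\<^bsub>free_mod R n\<^esub> v) = a \<otimes> row_pairing R n f v"
proof -
  have c: "f i \<in> carrier R" "v i \<in> carrier R" if "i < n" for i
    using assms that by (auto dest: free_mod_memD)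
  have "row_pairing R n f (a \<odot>\<^bsub>free_mod R n\<^esub> v) = (\<Oplus>i\<in>{..<n}. a \<otimes> (f i \<otimes> v i))"
    unfolding row_pairing_def
    by (rule finsum_cong') (use c assms(2) in \<open>auto simp: smult_free_mod m_lcomm\<close>)
  also have "\<dots> = a \<otimes> row_pairing R n f v"
    unfolding row_pairing_def by (rule finsum_rdistr[symmetric]) (use c assms in \<open>auto simp: Pi_def\<close>)
  finally show ?thesis .
qed

lemma row_pairing_cong:
  assumes "f \<in> {..<n} \<rightarrow> carrier R" "v \<in> {..<n} \<rightarrow> carrier R"
    and "\<And>i. i < n \<Longrightarrow> u i = v i"
  shows "row_pairing R n f u = row_pairing R n f v"
  unfolding row_pairing_def by (rule finsum_cong') (use assms in \<open>auto simp: Pi_def\<close>)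

lemma row_pairing_Suc:
  assumes "f \<in> {..<Suc n} \<rightarrow> carrier R" "v \<in> {..<Suc n} \<rightarrow> carrier R"
  shows "row_pairing R (Suc n) f v = f n \<otimes> v n \<oplus> row_pairing R n f v"
  unfolding row_pairing_def lessThan_Suc by (rule finsum_insert) (use assms in \<open>auto simp: Pi_def\<close>)

lemma row_pairing_split:
  assumes "f \<in> {..<n} \<rightarrow> carrier R" "v \<in> {..<n} \<rightarrow> carrier R" "i < n"
  shows "row_pairing R n f v = f i \<otimes> v i \<oplus> (\<Oplus>j\<in>{..<n} - {i}. f j \<otimes> v j)"
proof -
  have "{..<n} = insert i ({..<n} - {i})" using assms(3) by auto
  then have "row_pairing R n f v = (\<Oplus>j\<in>insert i ({..<n} - {i}). f j \<otimes> v j)"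
    unfolding row_pairing_def by simp
  also have "\<dots> = f i \<otimes> v i \<oplus> (\<Oplus>j\<in>{..<n} - {i}. f j \<otimes> v j)"
    by (rule finsum_insert) (use assms in \<open>auto simp: Pi_def\<close>)
  finally show ?thesis .
qed

lemma shear_row_closed:
  assumes "f \<in> {..<n} \<rightarrow> carrier R" "c \<in> {..<n} \<rightarrow> carrier R" "i < n"
  shows "shear_row R n i c f \<in> {..<n} \<rightarrow> carrier R"
  using assms by (auto simp: shear_row_def Pi_def intro!: finsum_closed)

lemma shear_closed:
  assumes "v \<in> carrier (free_mod R n)" "c \<in> {..<n} \<rightarrow> carrier R" "i < n"
  shows "shear R n i c v \<in> carrier (free_mod R n)"
  unfolding shear_def using assms by (intro restrict_in_free_mod) (auto dest: free_mod_memD)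

text \<open>The two shears are adjoint for the pairing, so that elementary operations on a row change its
  kernel by an automorphism and preserve unimodularity.\<close>

lemma row_pairing_shear:
  assumes f: "f \<in> {..<n} \<rightarrow> carrier R" and c: "c \<in> {..<n} \<rightarrow> carrier R"
    and i: "i < n" and v: "v \<in> carrier (free_mod R n)"
  shows "row_pairing R n f (shear R n i c v) = row_pairing R n (shear_row R n i c f) v"
proof -
  let ?J = "{..<n} - {i}"
  have vc: "v j \<in> carrier R" if "j < n" for j using v that by (rule free_mod_memD)
  define x where "x = v i"
  define S where "S = (\<Oplus>j\<in>?J. f j \<otimes> v j)"
  define C where "C = (\<Oplus>j\<in>?J. c j \<otimes> f j)"
  have cr: "f i \<in> carrier R" "x \<in> carrier R" "S \<in> carrier R" "C \<in> carrier R"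
    unfolding x_def S_def C_def using f c i vc by (auto intro!: finsum_closed simp: Pi_def)
  have "row_pairing R n f (shear R n i c v) =
      f i \<otimes> shear R n i c v i \<oplus> (\<Oplus>j\<in>?J. f j \<otimes> shear R n i c v j)"
    by (rule row_pairing_split) (use f i shear_closed[OF v c i] in \<open>auto dest: free_mod_memD\<close>)
  also have "shear R n i c v i = x" using i by (simp add: shear_def x_def)
  also have "(\<Oplus>j\<in>?J. f j \<otimes> shear R n i c v j) = (\<Oplus>j\<in>?J. f j \<otimes> v j \<oplus> (c j \<otimes> f j) \<otimes> x)"
  proof (rule finsum_cong')
    fix j assume j: "j \<in> ?J"
    then have "f j \<in> carrier R" "c j \<in> carrier R" "v j \<in> carrier R" using f c vc by auto
    then have "f j \<otimes> (v j \<oplus> c j \<otimes> x) = f j \<otimes> v j \<oplus> (c j \<otimes> f j) \<otimes> x" using cr(2) by algebra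
    then show "f j \<otimes> shear R n i c v j = f j \<otimes> v j \<oplus> (c j \<otimes> f j) \<otimes> x"
      using j by (simp add: shear_def x_def)
  qed (use f c vc cr in \<open>auto simp: Pi_def\<close>)
  also have "\<dots> = S \<oplus> (\<Oplus>j\<in>?J. (c j \<otimes> f j) \<otimes> x)"
    unfolding S_def by (rule finsum_addf) (use f c vc cr in \<open>auto simp: Pi_def\<close>)
  also have "(\<Oplus>j\<in>?J. (c j \<otimes> f j) \<otimes> x) = C \<otimes> x"
    unfolding C_def by (rule finsum_ldistr[symmetric]) (use f c vc cr in \<open>auto simp: Pi_def\<close>)
  also have "f i \<otimes> x \<oplus> (S \<oplus> C \<otimes> x) = (f i \<oplus> C) \<otimes> x \<oplus> S" using cr by algebra
  also have "\<dots> = shear_row R n i c f i \<otimes> v i \<oplus> (\<Oplus>j\<in>?J. shear_row R n i c f j \<otimes> v j)"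
  proof -
    have "S = (\<Oplus>j\<in>?J. shear_row R n i c f j \<otimes> v j)"
      unfolding S_def by (rule finsum_cong') (use f vc in \<open>auto simp: shear_row_def Pi_def\<close>)
    then show ?thesis by (simp add: shear_row_def C_def x_def)
  qed
  also have "\<dots> = row_pairing R n (shear_row R n i c f) v"
    by (rule row_pairing_split[symmetric]) (use shear_row_closed[OF f c i] vc i in \<open>auto simp: Pi_def\<close>)
  finally show ?thesis .
qed

lemma shear_inverse:
  assumes "v \<in> carrier (free_mod R n)" "c \<in> {..<n} \<rightarrow> carrier R" "c' \<in> {..<n} \<rightarrow> carrier R"
    "i < n" "\<And>j. j < n \<Longrightarrow> c j \<oplus> c' j = \<zero>"
  shows "shear R n i c (shear R n i c' v) = v"
proof (rule free_mod_eqI)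
  show "shear R n i c (shear R n i c' v) \<in> carrier (free_mod R n)"
    using assms by (intro shear_closed)
  fix j assume j: "j < n"
  have cr: "v j \<in> carrier R" "v i \<in> carrier R" "c j \<in> carrier R" "c' j \<in> carrier R"
    using assms j by (auto dest: free_mod_memD)
  have "(v j \<oplus> c' j \<otimes> v i) \<oplus> c j \<otimes> v i = v j \<oplus> (c j \<oplus> c' j) \<otimes> v i"
    using cr by algebra
  then show "shear R n i c (shear R n i c' v) j = v j"
    using j assms(4,5) cr by (simp add: shear_def)
qed (use assms in simp)

lemma shear_iso:
  assumes f: "f \<in> {..<n} \<rightarrow> carrier R" and c: "c \<in> {..<n} \<rightarrow> carrier R" and i: "i < n"
  shows "shear R n i c \<in> module_iso R (row_kernel R n (shear_row R n i c f)) (row_kernel R n f)"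
proof (rule module_isoI)
  let ?c = "\<lambda>j. \<ominus> c j"
  have c': "?c \<in> {..<n} \<rightarrow> carrier R" using c by auto
  have inv1: "shear R n i c (shear R n i ?c v) = v" "shear R n i ?c (shear R n i c v) = v"
    if "v \<in> carrier (free_mod R n)" for v
    using that c by (auto intro!: shear_inverse c' i simp: r_neg l_neg Pi_def)
  have pair: "row_pairing R n (shear_row R n i c f) (shear R n i ?c v) = row_pairing R n f v"
    if "v \<in> carrier (free_mod R n)" for v
    using row_pairing_shear[OF f c i shear_closed[OF that c' i]] inv1(1)[OF that] by simp
  show "bij_betw (shear R n i c) (carrier (row_kernel R n (shear_row R n i c f)))
      (carrier (row_kernel R n f))"
    by (rule bij_betw_byWitness[of _ "shear R n i ?c"])
       (use inv1 pair shear_closed[OF _ c i] shear_closed[OF _ c' i] row_pairing_shear[OF f c i] in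
          \<open>auto simp: row_kernel_simps\<close>)
next
  fix u v assume "u \<in> carrier (row_kernel R n (shear_row R n i c f))" "v \<in> carrier (row_kernel R n (shear_row R n i c f))"
  then have uv: "u j \<in> carrier R" "v j \<in> carrier R" if "j < n" for j
    using that by (auto simp: row_kernel_simps dest: free_mod_memD)
  show "shear R n i c (u \<oplus>\<^bsub>row_kernel R n (shear_row R n i c f)\<^esub> v) =
      shear R n i c u \<oplus>\<^bsub>row_kernel R n f\<^esub> shear R n i c v"
    unfolding row_kernel_simps add_free_mod shear_def
  proof (rule restrict_ext)
    fix j assume "j \<in> {..<n}"
    then have cr: "u j \<in> carrier R" "v j \<in> carrier R" "u i \<in> carrier R" "v i \<in> carrier R" "c j \<in> carrier R"
      using uv c i by auto
    then have "(u j \<oplus> v j) \<oplus> c j \<otimes> (u i \<oplus> v i) = (u j \<oplus> c j \<otimes> u i) \<oplus> (v j \<oplus> c j \<otimes> v i)" by algebra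
    then show "(if j = i then (\<lambda>i\<in>{..<n}. u i \<oplus> v i) i
        else (\<lambda>i\<in>{..<n}. u i \<oplus> v i) j \<oplus> c j \<otimes> (\<lambda>i\<in>{..<n}. u i \<oplus> v i) i) =
      (\<lambda>j\<in>{..<n}. if j = i then u i else u j \<oplus> c j \<otimes> u i) j \<oplus>
      (\<lambda>j\<in>{..<n}. if j = i then v i else v j \<oplus> c j \<otimes> v i) j"
      using \<open>j \<in> {..<n}\<close> i by auto
  qed
next
  fix a v assume a: "a \<in> carrier R" and "v \<in> carrier (row_kernel R n (shear_row R n i c f))"
  then have v: "v j \<in> carrier R" if "j < n" for j
    using that by (auto simp: row_kernel_simps dest: free_mod_memD)
  show "shear R n i c (a \<odot>\<^bsub>row_kernel R n (shear_row R n i c f)\<^esub> v) =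
      a \<odot>\<^bsub>row_kernel R n f\<^esub> shear R n i c v"
    unfolding row_kernel_simps smult_free_mod shear_def
  proof (rule restrict_ext)
    fix j assume "j \<in> {..<n}"
    then have cr: "v j \<in> carrier R" "v i \<in> carrier R" "c j \<in> carrier R"
      using v c i by auto
    then have "a \<otimes> v j \<oplus> c j \<otimes> (a \<otimes> v i) = a \<otimes> (v j \<oplus> c j \<otimes> v i)" using a by algebra
    then show "(if j = i then (\<lambda>i\<in>{..<n}. a \<otimes> v i) i
        else (\<lambda>i\<in>{..<n}. a \<otimes> v i) j \<oplus> c j \<otimes> (\<lambda>i\<in>{..<n}. a \<otimes> v i) i) =
      a \<otimes> (\<lambda>j\<in>{..<n}. if j = i then v i else v j \<oplus> c j \<otimes> v i) j"
      using \<open>j \<in> {..<n}\<close> i by auto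
  qed
qed

lemma has_free_kernel_of_shear:
  assumes "f \<in> {..<n} \<rightarrow> carrier R" "c \<in> {..<n} \<rightarrow> carrier R" "i < n"
    and "has_free_kernel R n (shear_row R n i c f)"
  shows "has_free_kernel R n f"
proof -
  obtain k \<tau> where "\<tau> \<in> module_iso R (free_mod R k) (row_kernel R n (shear_row R n i c f))"
    using assms(4) by (auto simp: has_free_kernel_def)
  then have "shear R n i c \<circ> \<tau> \<in> module_iso R (free_mod R k) (row_kernel R n f)"
    using shear_iso[OF assms(1-3)] by (rule module_iso_comp)
  then show ?thesis unfolding has_free_kernel_def by blast
qed

lemma unimodular_shear:
  assumes "unimodular_row R n f" and c: "c \<in> {..<n} \<rightarrow> carrier R" and i: "i < n"
  shows "unimodular_row R n (shear_row R n i c f)"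
proof -
  obtain g where f: "f \<in> {..<n} \<rightarrow> carrier R" and g: "g \<in> carrier (free_mod R n)"
    "row_pairing R n f g = \<one>" using assms(1) by (auto simp: unimodular_row_def)
  let ?c = "\<lambda>j. \<ominus> c j"
  have c': "?c \<in> {..<n} \<rightarrow> carrier R" using c by auto
  have "row_pairing R n (shear_row R n i c f) (shear R n i ?c g) = \<one>"
  proof -
    have "shear R n i c (shear R n i ?c g) = g"
      using c by (intro shear_inverse[OF g(1) c c' i]) (auto simp: r_neg Pi_def)
    then show ?thesis using row_pairing_shear[OF f c i shear_closed[OF g(1) c' i]] g(2) by simp
  qed
  then show ?thesis unfolding unimodular_row_def
    using shear_row_closed[OF f c i] shear_closed[OF g(1) c' i] by blast
qed

lemma shear_row_single:
  assumes "f \<in> {..<n} \<rightarrow> carrier R" "q \<in> carrier R" "i < n" "k < n" "i \<noteq> k"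
  shows "shear_row R n i (\<lambda>j. if k = j then q else \<zero>) f = f(i := f i \<oplus> q \<otimes> f k)"
proof -
  have "(\<Oplus>j\<in>{..<n} - {i}. (if k = j then q else \<zero>) \<otimes> f j) = (\<Oplus>j\<in>{..<n} - {i}. if k = j then q \<otimes> f j else \<zero>)"
    by (rule finsum_cong') (use assms in \<open>auto simp: Pi_def\<close>)
  also have "\<dots> = q \<otimes> f k"
    by (rule add.finprod_singleton) (use assms in \<open>auto simp: Pi_def\<close>)
  finally show ?thesis by (simp add: shear_row_def)
qed

lemma has_free_kernel_add_multiple:
  assumes "f \<in> {..<n} \<rightarrow> carrier R" "q \<in> carrier R" "i < n" "k < n" "i \<noteq> k"
    and "has_free_kernel R n (f(i := f i \<oplus> q \<otimes> f k))"
  shows "has_free_kernel R n f"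
  using has_free_kernel_of_shear[of f n "\<lambda>j. if k = j then q else \<zero>" i] shear_row_single[OF assms(1-5)] assms
  by auto

lemma unimodular_add_multiple:
  assumes "unimodular_row R n f" "q \<in> carrier R" "i < n" "k < n" "i \<noteq> k"
  shows "unimodular_row R n (f(i := f i \<oplus> q \<otimes> f k))"
  using unimodular_shear[OF assms(1), of "\<lambda>j. if k = j then q else \<zero>" i] shear_row_single[of f n q i k] assms
  by (auto simp: unimodular_row_def)

end

section \<open>Rows with free kernel\<close>

context cring
begin

text \<open>The equation of the kernel can be solved for the last coordinate; the others are free.\<close>

lemma has_free_kernel_last_unit:
  assumes f: "f \<in> {..<Suc n} \<rightarrow> carrier R" and w: "w \<in> carrier R" "f n \<otimes> w = \<one>"
  shows "has_free_kernel R (Suc n) f"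
proof -
  have fn: "f \<in> {..<n} \<rightarrow> carrier R" and fnc: "f n \<in> carrier R" using f by auto
  let ?p = "row_pairing R n f"
  define \<tau> where "\<tau> v = (\<lambda>i\<in>{..<Suc n}. if i < n then v i else \<ominus> w \<otimes> ?p v)" for v
  have vm: "v \<in> {..<n} \<rightarrow> carrier R" if "v \<in> carrier (free_mod R n)" for v
    using that by (auto dest: free_mod_memD)
  have pc: "?p v \<in> carrier R" if "v \<in> carrier (free_mod R n)" for v
    using that by (intro row_pairing_closed fn vm)
  have \<tau>c: "\<tau> v \<in> carrier (free_mod R (Suc n))" if "v \<in> carrier (free_mod R n)" for v
    unfolding \<tau>_def using that w pc by (intro restrict_in_free_mod) (auto dest: free_mod_memD)
  have p\<tau>: "?p (\<tau> v) = ?p v" if "v \<in> carrier (free_mod R n)" for v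
    by (rule row_pairing_cong) (use fn vm[OF that] in \<open>auto simp: \<tau>_def\<close>)
  have ker: "row_pairing R (Suc n) f (\<tau> v) = \<zero>" if v: "v \<in> carrier (free_mod R n)" for v
  proof -
    have "row_pairing R (Suc n) f (\<tau> v) = f n \<otimes> \<tau> v n \<oplus> ?p (\<tau> v)"
      using \<tau>c[OF v] by (intro row_pairing_Suc f) (auto dest: free_mod_memD)
    also have "\<dots> = f n \<otimes> (\<ominus> w \<otimes> ?p v) \<oplus> ?p v" using p\<tau>[OF v] by (simp add: \<tau>_def)
    also have "\<dots> = \<ominus> (f n \<otimes> w) \<otimes> ?p v \<oplus> ?p v"
      using fnc w(1) pc[OF v] by algebra
    also have "\<dots> = \<zero>" using w pc[OF v] by (simp add: l_minus l_neg)
    finally show ?thesis .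
  qed
  have "\<tau> \<in> module_iso R (free_mod R n) (row_kernel R (Suc n) f)"
  proof (rule module_isoI)
    show "bij_betw \<tau> (carrier (free_mod R n)) (carrier (row_kernel R (Suc n) f))"
    proof (rule bij_betw_byWitness[of _ "\<lambda>v. \<lambda>i\<in>{..<n}. v i"])
      show "\<forall>v\<in>carrier (free_mod R n). (\<lambda>i\<in>{..<n}. \<tau> v i) = v"
      proof
        fix v assume v: "v \<in> carrier (free_mod R n)"
        show "(\<lambda>i\<in>{..<n}. \<tau> v i) = v"
        proof (rule free_mod_eqI[OF _ v])
          show "(\<lambda>i\<in>{..<n}. \<tau> v i) \<in> carrier (free_mod R n)"
            by (intro restrict_in_free_mod) (simp add: free_mod_memD[OF \<tau>c[OF v]])
        qed (simp add: \<tau>_def)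
      qed
      show "\<tau> ` carrier (free_mod R n) \<subseteq> carrier (row_kernel R (Suc n) f)"
        using \<tau>c ker by (auto simp: row_kernel_simps)
      show "(\<lambda>v. \<lambda>i\<in>{..<n}. v i) ` carrier (row_kernel R (Suc n) f) \<subseteq> carrier (free_mod R n)"
      proof (clarify)
        fix v assume "v \<in> carrier (row_kernel R (Suc n) f)"
        then show "(\<lambda>i\<in>{..<n}. v i) \<in> carrier (free_mod R n)"
          by (intro restrict_in_free_mod) (auto simp: row_kernel_simps intro: free_mod_memD[where n = "Suc n"])
      qed
      show "\<forall>v\<in>carrier (row_kernel R (Suc n) f). \<tau> (\<lambda>i\<in>{..<n}. v i) = v"
      proof
        fix v assume "v \<in> carrier (row_kernel R (Suc n) f)"
        then have v: "v \<in> carrier (free_mod R (Suc n))" and v0: "row_pairing R (Suc n) f v = \<zero>"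
          by (auto simp: row_kernel_simps)
        have vi: "v i \<in> carrier R" if "i < Suc n" for i using v that by (rule free_mod_memD)
        let ?v = "\<lambda>i\<in>{..<n}. v i"
        have vr: "?v \<in> carrier (free_mod R n)" using vi by (intro restrict_in_free_mod) auto
        have "?p ?v = ?p v" by (rule row_pairing_cong) (use fn vi in auto)
        moreover have "row_pairing R (Suc n) f v = f n \<otimes> v n \<oplus> ?p v"
          using vi by (intro row_pairing_Suc f) auto
        ultimately have "f n \<otimes> v n \<oplus> ?p ?v = \<zero>" using v0 by simp
        moreover have "(f n \<otimes> w) \<otimes> y = w \<otimes> (f n \<otimes> y \<oplus> x) \<oplus> \<ominus> w \<otimes> x"
          if "x \<in> carrier R" "y \<in> carrier R" for x y
          using fnc w(1) that by algebra
        ultimately have "(f n \<otimes> w) \<otimes> v n = w \<otimes> \<zero> \<oplus> \<ominus> w \<otimes> ?p ?v"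
          using pc[OF vr] vi[of n] by simp
        then have "v n = \<ominus> w \<otimes> ?p ?v" using w vi[of n] pc[OF vr] by simp
        show "\<tau> ?v = v"
        proof (rule free_mod_eqI[OF \<tau>c[OF vr] v])
          fix i assume "i < Suc n"
          then show "\<tau> ?v i = v i" using \<open>v n = \<ominus> w \<otimes> ?p ?v\<close>
            by (cases "i = n") (auto simp: \<tau>_def)
        qed
      qed
    qed
  next
    fix u v assume uv: "u \<in> carrier (free_mod R n)" "v \<in> carrier (free_mod R n)"
    show "\<tau> (u \<oplus>\<^bsub>free_mod R n\<^esub> v) = \<tau> u \<oplus>\<^bsub>row_kernel R (Suc n) f\<^esub> \<tau> v"
      unfolding row_kernel_simps add_free_mod[of R "Suc n"] \<tau>_def row_pairing_add[OF fn uv]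
      by (rule restrict_ext) (use w pc uv in \<open>auto simp: add_free_mod r_distr\<close>)
  next
    fix a v assume a: "a \<in> carrier R" and v: "v \<in> carrier (free_mod R n)"
    show "\<tau> (a \<odot>\<^bsub>free_mod R n\<^esub> v) = a \<odot>\<^bsub>row_kernel R (Suc n) f\<^esub> \<tau> v"
      unfolding row_kernel_simps smult_free_mod[of R "Suc n"] \<tau>_def row_pairing_smult[OF fn a v]
      by (rule restrict_ext) (use w pc v a in \<open>auto simp: smult_free_mod m_lcomm\<close>)
  qed
  then show ?thesis unfolding has_free_kernel_def by blast
qed

text \<open>An entry \<open>1\<close> in another position serves to make the last entry \<open>1\<close>.\<close>

lemma has_free_kernel_unit:
  assumes f: "f \<in> {..<n} \<rightarrow> carrier R" and l: "l < n" "f l = \<one>"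
  shows "has_free_kernel R n f"
proof -
  obtain m where n: "n = Suc m" using l by (cases n) auto
  have fm: "f m \<in> carrier R" using f n by auto
  show ?thesis
  proof (cases "l = m")
    case True
    then show ?thesis using has_free_kernel_last_unit[of f m \<one>] f l n by simp
  next
    case False
    let ?q = "\<one> \<ominus> f m"
    let ?f = "f(m := f m \<oplus> ?q \<otimes> f l)"
    have "?f m = \<one>" using fm l by (simp add: a_minus_def) (metis a_comm a_inv_closed add.inv_solve_right one_closed r_neg2 minus_minus)
    moreover have "?f \<in> {..<Suc m} \<rightarrow> carrier R" using f fm l n by auto
    ultimately have "has_free_kernel R n ?f"
      using has_free_kernel_last_unit[of ?f m \<one>] n by simp
    then show ?thesis
      using has_free_kernel_add_multiple[OF f, of ?q m l] fm l n False by auto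
  qed
qed

lemma has_free_kernel_0: "has_free_kernel R 0 f"
proof -
  have "carrier (row_kernel R 0 f) = carrier (free_mod R 0)"
    by (simp add: row_kernel_simps row_pairing_def)
  then have "(\<lambda>v. v) \<in> module_iso R (free_mod R 0) (row_kernel R 0 f)"
    by (intro module_isoI) (auto simp: row_kernel_simps bij_betw_def)
  then show ?thesis unfolding has_free_kernel_def by blast
qed

text \<open>If \<open>f\<^sub>0 g\<^sub>0 + f\<^sub>1 g\<^sub>1 = 1\<close>, then the kernel is generated by the vector \<open>(- f\<^sub>1, f\<^sub>0)\<close>, and
  \<open>v \<mapsto> g\<^sub>0 v\<^sub>1 - g\<^sub>1 v\<^sub>0\<close> reads off the coefficient.\<close>

lemma has_free_kernel_2:
  assumes "unimodular_row R 2 f"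
  shows "has_free_kernel R 2 f"
proof -
  have two: "{..<2::nat} = {0, 1}" by auto
  obtain g where f: "f \<in> {..<2} \<rightarrow> carrier R" and g: "g \<in> carrier (free_mod R 2)"
    and fg: "row_pairing R 2 f g = \<one>" using assms by (auto simp: unimodular_row_def)
  have pair: "row_pairing R 2 f v = f 0 \<otimes> v 0 \<oplus> f 1 \<otimes> v 1" if "v \<in> carrier (free_mod R 2)" for v
    unfolding row_pairing_def two using f free_mod_memD[OF that] by (subst finsum_insert) (auto simp: Pi_def)
  have fc: "f 0 \<in> carrier R" "f 1 \<in> carrier R" using f by auto
  have gc: "g 0 \<in> carrier R" "g 1 \<in> carrier R" using free_mod_memD[OF g] by auto
  have e: "f 0 \<otimes> g 0 \<oplus> f 1 \<otimes> g 1 = \<one>" using pair[OF g] fg by simp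
  define \<tau> where "\<tau> v = (\<lambda>i\<in>{..<2::nat}. if i = 0 then \<ominus> f 1 \<otimes> v (0::nat) else f 0 \<otimes> v 0)" for v
  define \<sigma> where "\<sigma> v = (\<lambda>i\<in>{..<1::nat}. g 0 \<otimes> v (1::nat) \<ominus> g 1 \<otimes> v 0)" for v
  have \<tau>c: "\<tau> v \<in> carrier (free_mod R 2)" if "v \<in> carrier (free_mod R 1)" for v
    unfolding \<tau>_def using fc free_mod_memD[OF that] by (intro restrict_in_free_mod) auto
  have \<sigma>c: "\<sigma> v \<in> carrier (free_mod R 1)" if "v \<in> carrier (free_mod R 2)" for v
    unfolding \<sigma>_def using gc free_mod_memD[OF that] by (intro restrict_in_free_mod) auto
  have "\<tau> \<in> module_iso R (free_mod R 1) (row_kernel R 2 f)"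
  proof (rule module_isoI)
    show "bij_betw \<tau> (carrier (free_mod R 1)) (carrier (row_kernel R 2 f))"
    proof (rule bij_betw_byWitness[of _ \<sigma>])
      show "\<forall>v\<in>carrier (free_mod R 1). \<sigma> (\<tau> v) = v"
      proof
        fix v assume v: "v \<in> carrier (free_mod R 1)"
        then have vc: "v 0 \<in> carrier R" by (auto dest: free_mod_memD)
        have "g 0 \<otimes> (f 0 \<otimes> v 0) \<ominus> g 1 \<otimes> (\<ominus> f 1 \<otimes> v 0) = (f 0 \<otimes> g 0 \<oplus> f 1 \<otimes> g 1) \<otimes> v 0"
          using vc fc gc by algebra
        also have "\<dots> = v 0" unfolding e using vc by simp
        finally show "\<sigma> (\<tau> v) = v"
          by (intro free_mod_eqI[OF \<sigma>c[OF \<tau>c[OF v]] v]) (simp add: \<sigma>_def \<tau>_def)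
      qed
      show "\<forall>v\<in>carrier (row_kernel R 2 f). \<tau> (\<sigma> v) = v"
      proof
        fix v assume "v \<in> carrier (row_kernel R 2 f)"
        then have v: "v \<in> carrier (free_mod R 2)" and "row_pairing R 2 f v = \<zero>"
          by (auto simp: row_kernel_simps)
        then have v0: "f 0 \<otimes> v 0 \<oplus> f 1 \<otimes> v 1 = \<zero>" using pair by simp
        have vc: "v 0 \<in> carrier R" "v 1 \<in> carrier R" using free_mod_memD[OF v] by auto
        have "\<ominus> f 1 \<otimes> (g 0 \<otimes> v 1 \<ominus> g 1 \<otimes> v 0) =
            (f 0 \<otimes> g 0 \<oplus> f 1 \<otimes> g 1) \<otimes> v 0 \<ominus> g 0 \<otimes> (f 0 \<otimes> v 0 \<oplus> f 1 \<otimes> v 1)"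
          using vc fc gc by algebra
        also have "\<dots> = v 0" unfolding e v0 using vc gc by (simp add: a_minus_def)
        finally have 0: "\<ominus> f 1 \<otimes> (g 0 \<otimes> v 1 \<ominus> g 1 \<otimes> v 0) = v 0" .
        have "f 0 \<otimes> (g 0 \<otimes> v 1 \<ominus> g 1 \<otimes> v 0) =
            (f 0 \<otimes> g 0 \<oplus> f 1 \<otimes> g 1) \<otimes> v 1 \<ominus> g 1 \<otimes> (f 0 \<otimes> v 0 \<oplus> f 1 \<otimes> v 1)"
          using vc fc gc by algebra
        also have "\<dots> = v 1" unfolding e v0 using vc gc by (simp add: a_minus_def)
        finally have 1: "f 0 \<otimes> (g 0 \<otimes> v 1 \<ominus> g 1 \<otimes> v 0) = v 1" .
        show "\<tau> (\<sigma> v) = v"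
        proof (rule free_mod_eqI[OF \<tau>c[OF \<sigma>c[OF v]] v])
          fix i :: nat assume "i < 2"
          then consider "i = 0" | "i = 1" by linarith
          then show "\<tau> (\<sigma> v) i = v i" using 0 1 by cases (simp_all add: \<sigma>_def \<tau>_def)
        qed
      qed
      show "\<tau> ` carrier (free_mod R 1) \<subseteq> carrier (row_kernel R 2 f)"
      proof clarify
        fix v assume v: "v \<in> carrier (free_mod R 1)"
        then have vc: "v 0 \<in> carrier R" by (auto dest: free_mod_memD)
        have "f 0 \<otimes> (\<ominus> f 1 \<otimes> v 0) \<oplus> f 1 \<otimes> (f 0 \<otimes> v 0) = \<zero>" using vc fc by algebra
        then show "\<tau> v \<in> carrier (row_kernel R 2 f)"
          using \<tau>c[OF v] pair by (simp add: row_kernel_simps \<tau>_def)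
      qed
      show "\<sigma> ` carrier (row_kernel R 2 f) \<subseteq> carrier (free_mod R 1)"
        using \<sigma>c by (auto simp: row_kernel_simps)
    qed
  next
    fix u v assume "u \<in> carrier (free_mod R 1)" "v \<in> carrier (free_mod R 1)"
    then have "u 0 \<in> carrier R" "v 0 \<in> carrier R" by (auto dest: free_mod_memD)
    then show "\<tau> (u \<oplus>\<^bsub>free_mod R 1\<^esub> v) = \<tau> u \<oplus>\<^bsub>row_kernel R 2 f\<^esub> \<tau> v"
      unfolding row_kernel_simps add_free_mod \<tau>_def
      by (intro restrict_ext) (use fc in \<open>auto simp: r_distr\<close>)
  next
    fix a v assume "a \<in> carrier R" "v \<in> carrier (free_mod R 1)"
    then have "a \<in> carrier R" "v 0 \<in> carrier R" by (auto dest: free_mod_memD)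
    then show "\<tau> (a \<odot>\<^bsub>free_mod R 1\<^esub> v) = a \<odot>\<^bsub>row_kernel R 2 f\<^esub> \<tau> v"
      unfolding row_kernel_simps smult_free_mod \<tau>_def
      by (intro restrict_ext) (use fc in \<open>auto simp: m_lcomm\<close>)
  qed
  then show ?thesis unfolding has_free_kernel_def by blast
qed

lemma has_free_kernel_short:
  assumes "unimodular_row R n f" "n \<le> 2"
  shows "has_free_kernel R n f"
proof -
  consider "n = 0" | "n = 1" | "n = 2" using assms(2) by linarith
  then show ?thesis
  proof cases
    case 1
    then show ?thesis using has_free_kernel_0 by simp
  next
    case 2
    then obtain g where f: "f \<in> {..<Suc 0} \<rightarrow> carrier R" and g: "g \<in> carrier (free_mod R (Suc 0))"
      and fg: "row_pairing R (Suc 0) f g = \<one>" using assms(1) by (auto simp: unimodular_row_def)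
    have "f 0 \<in> carrier R" "g 0 \<in> carrier R" using f g by (auto dest: free_mod_memD)
    then have "f 0 \<otimes> g 0 = \<one>" using fg by (simp add: row_pairing_def lessThan_Suc)
    then show ?thesis using has_free_kernel_last_unit[OF f, of "g 0"] \<open>g 0 \<in> carrier R\<close> 2 by simp
  next
    case 3
    then show ?thesis using has_free_kernel_2 assms(1) by simp
  qed
qed

end

section \<open>Complements of free modules\<close>

definition unit_vec :: "('r, 'k) ring_scheme \<Rightarrow> nat \<Rightarrow> nat \<Rightarrow> nat \<Rightarrow> 'r" where
  "unit_vec R n i = (\<lambda>j\<in>{..<n}. if j = i then \<one>\<^bsub>R\<^esub> else \<zero>\<^bsub>R\<^esub>)"

text \<open>The ring as a module over itself, so that linear forms are linear maps between modules.\<close>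

definition self_mod :: "('r, 'k) ring_scheme \<Rightarrow> ('r, 'r) module" where
  "self_mod R = \<lparr>carrier = carrier R, mult = undefined, one = undefined, zero = \<zero>\<^bsub>R\<^esub>,
     add = add R, smult = mult R\<rparr>"

context cring
begin

lemma unit_vec_closed: "unit_vec R n i \<in> carrier (free_mod R n)"
  unfolding unit_vec_def by (rule restrict_in_free_mod) auto

lemma module_self_mod: "module R (self_mod R)"
proof (rule moduleI[OF cring_axioms])
  show "abelian_group (self_mod R)"
  proof (rule abelian_groupI)
    fix x assume "x \<in> carrier (self_mod R)"
    then have "\<ominus> x \<in> carrier (self_mod R)" "\<ominus> x \<oplus>\<^bsub>self_mod R\<^esub> x = \<zero>\<^bsub>self_mod R\<^esub>"
      by (simp_all add: self_mod_def l_neg)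
    then show "\<exists>y\<in>carrier (self_mod R). y \<oplus>\<^bsub>self_mod R\<^esub> x = \<zero>\<^bsub>self_mod R\<^esub>" by blast
  qed (simp_all add: self_mod_def a_ac)
qed (simp_all add: self_mod_def l_distr r_distr m_assoc)

lemma finsum_self_mod:
  assumes "finite A" "f \<in> A \<rightarrow> carrier R"
  shows "finsum (self_mod R) f A = finsum R f A"
proof -
  interpret S: module R "self_mod R" by (rule module_self_mod)
  show ?thesis using assms
  proof (induction A)
    case empty
    show ?case unfolding S.M.finsum_empty finsum_empty by (simp add: self_mod_def)
  next
    case (insert x A)
    then show ?case by (subst S.M.finsum_insert) (auto simp: self_mod_def Pi_def)
  qed
qed

text \<open>Induction on the number of coordinates that are not truncated to zero.\<close>

lemma linear_eq_sum:
  assumes "module R N" and closed: "\<And>v. v \<in> carrier (free_mod R k) \<Longrightarrow> \<psi> v \<in> carrier N"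
    and add: "\<And>u v. u \<in> carrier (free_mod R k) \<Longrightarrow> v \<in> carrier (free_mod R k) \<Longrightarrow>
      \<psi> (u \<oplus>\<^bsub>free_mod R k\<^esub> v) = \<psi> u \<oplus>\<^bsub>N\<^esub> \<psi> v"
    and smult: "\<And>a v. a \<in> carrier R \<Longrightarrow> v \<in> carrier (free_mod R k) \<Longrightarrow>
      \<psi> (a \<odot>\<^bsub>free_mod R k\<^esub> v) = a \<odot>\<^bsub>N\<^esub> \<psi> v"
    and v: "v \<in> carrier (free_mod R k)"
  shows "\<psi> v = (\<Oplus>\<^bsub>N\<^esub>i\<in>{..<k}. v i \<odot>\<^bsub>N\<^esub> \<psi> (unit_vec R k i))"
proof -
  interpret N: module R N by fact
  have vi: "v i \<in> carrier R" if "i < k" for i using v that by (rule free_mod_memD)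
  define w where "w m = (\<lambda>i\<in>{..<k}. if i < m then v i else \<zero>)" for m
  have wc: "w m \<in> carrier (free_mod R k)" for m
    unfolding w_def using vi by (intro restrict_in_free_mod) auto
  have "m \<le> k \<Longrightarrow> \<psi> (w m) = (\<Oplus>\<^bsub>N\<^esub>i\<in>{..<m}. v i \<odot>\<^bsub>N\<^esub> \<psi> (unit_vec R k i))" for m
  proof (induction m)
    case 0
    have "w 0 = \<zero> \<odot>\<^bsub>free_mod R k\<^esub> v"
      unfolding smult_free_mod w_def by (rule restrict_ext) (use vi in auto)
    then have "\<psi> (w 0) = \<zero>\<^bsub>N\<^esub>" using smult[of \<zero> v] v closed[OF v] by simp
    then show ?case by simp
  next
    case (Suc m)
    then have m: "m < k" by simp
    have "w (Suc m) = v m \<odot>\<^bsub>free_mod R k\<^esub> unit_vec R k m \<oplus>\<^bsub>free_mod R k\<^esub> w m"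
      unfolding add_free_mod smult_free_mod w_def unit_vec_def
      by (rule restrict_ext) (use vi vi[OF m] m in \<open>auto simp: less_Suc_eq\<close>)
    moreover have "v m \<odot>\<^bsub>free_mod R k\<^esub> unit_vec R k m \<in> carrier (free_mod R k)"
      unfolding smult_free_mod using vi[OF m] free_mod_memD[OF unit_vec_closed]
      by (intro restrict_in_free_mod) auto
    ultimately have "\<psi> (w (Suc m)) = v m \<odot>\<^bsub>N\<^esub> \<psi> (unit_vec R k m) \<oplus>\<^bsub>N\<^esub> \<psi> (w m)"
      using add smult wc unit_vec_closed vi[OF m] by simp
    also have "\<dots> = (\<Oplus>\<^bsub>N\<^esub>i\<in>insert m {..<m}. v i \<odot>\<^bsub>N\<^esub> \<psi> (unit_vec R k i))"
      using Suc m vi closed unit_vec_closed by (subst N.M.finsum_insert) auto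
    finally show ?case by (simp add: lessThan_Suc)
  qed
  moreover have "w k = v" by (rule free_mod_eqI[OF wc v]) (simp add: w_def)
  ultimately show ?thesis by auto
qed

text \<open>The images of the unit vectors form a basis.  In the zero ring these vectors coincide, but
  there every module is trivial and the empty set is a basis.\<close>

lemma is_free_of_iso:
  assumes "module R M" and iso: "\<psi> \<in> module_iso R (free_mod R k) M"
  shows "is_free R M"
proof -
  interpret M: module R M by fact
  show ?thesis
  proof (cases "\<one> = \<zero>")
    case True
    have "x = \<zero>\<^bsub>M\<^esub>" if "x \<in> carrier M" for x
      using that M.smult_one[of x] M.smult_l_null[of x] unfolding True by simp
    then have "is_basis R M {}" by (auto simp: is_basis_def)
    then show ?thesis unfolding is_free_def by blast
  next
    case False
    have bij: "bij_betw \<psi> (carrier (free_mod R k)) (carrier M)"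
      and add: "\<And>u v. u \<in> carrier (free_mod R k) \<Longrightarrow> v \<in> carrier (free_mod R k) \<Longrightarrow>
        \<psi> (u \<oplus>\<^bsub>free_mod R k\<^esub> v) = \<psi> u \<oplus>\<^bsub>M\<^esub> \<psi> v"
      and smult: "\<And>a v. a \<in> carrier R \<Longrightarrow> v \<in> carrier (free_mod R k) \<Longrightarrow>
        \<psi> (a \<odot>\<^bsub>free_mod R k\<^esub> v) = a \<odot>\<^bsub>M\<^esub> \<psi> v"
      using iso by (auto simp: module_iso_def)
    have closed: "\<psi> v \<in> carrier M" if "v \<in> carrier (free_mod R k)" for v
      using bij that by (rule bij_betwE[rule_format])
    define b where "b i = \<psi> (unit_vec R k i)" for i
    define B where "B = b ` {..<k}"
    have bc: "b i \<in> carrier M" for i unfolding b_def by (intro closed unit_vec_closed)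
    have inj: "inj_on b {..<k}"
    proof (rule inj_onI)
      fix i j assume ij: "i \<in> {..<k}" "j \<in> {..<k}" "b i = b j"
      then have "unit_vec R k i = unit_vec R k j"
        using bij unit_vec_closed unfolding b_def bij_betw_def by (auto dest: inj_onD)
      then have "unit_vec R k i i = unit_vec R k j i" by simp
      then show "i = j" using False ij by (auto simp: unit_vec_def split: if_splits)
    qed
    have sum: "(\<Oplus>\<^bsub>M\<^esub>x\<in>{x\<in>B. c x \<noteq> \<zero>}. c x \<odot>\<^bsub>M\<^esub> x) = \<psi> (\<lambda>i\<in>{..<k}. c (b i))"
      if c: "c \<in> B \<rightarrow>\<^sub>E carrier R" for c
    proof -
      have cb: "c (b i) \<in> carrier R" if "i < k" for i using c that by (auto simp: B_def)
      have "(\<Oplus>\<^bsub>M\<^esub>x\<in>{x\<in>B. c x \<noteq> \<zero>}. c x \<odot>\<^bsub>M\<^esub> x) = (\<Oplus>\<^bsub>M\<^esub>x\<in>B. c x \<odot>\<^bsub>M\<^esub> x)"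
        by (rule M.M.add.finprod_mono_neutral_cong_left) (use c bc in \<open>auto simp: B_def\<close>)
      also have "\<dots> = (\<Oplus>\<^bsub>M\<^esub>i\<in>{..<k}. c (b i) \<odot>\<^bsub>M\<^esub> b i)"
        unfolding B_def by (rule M.M.finsum_reindex[OF _ inj]) (use cb bc in auto)
      also have "\<dots> = (\<Oplus>\<^bsub>M\<^esub>i\<in>{..<k}. (\<lambda>i\<in>{..<k}. c (b i)) i \<odot>\<^bsub>M\<^esub> \<psi> (unit_vec R k i))"
        by (rule M.M.finsum_cong') (use cb bc in \<open>auto simp: b_def\<close>)
      also have "\<dots> = \<psi> (\<lambda>i\<in>{..<k}. c (b i))"
        by (rule linear_eq_sum[symmetric, OF assms(1) closed add smult restrict_in_free_mod])
           (assumption | rule cb)+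
      finally show ?thesis .
    qed
    have "is_basis R M B"
      unfolding is_basis_def
    proof (intro conjI ballI)
      show "B \<subseteq> carrier M" using bc by (auto simp: B_def)
      fix x assume "x \<in> carrier M"
      then have "x \<in> \<psi> ` carrier (free_mod R k)" using bij_betw_imp_surj_on[OF bij] by simp
      then obtain v where v: "v \<in> carrier (free_mod R k)" "\<psi> v = x" by blast
      define c where "c = (\<lambda>y\<in>B. v (inv_into {..<k} b y))"
      have ci: "c (b i) = v i" if "i < k" for i
        using that inj by (simp add: c_def B_def inv_into_f_f)
      have c: "c \<in> B \<rightarrow>\<^sub>E carrier R"
        using free_mod_memD[OF v(1)] ci by (auto simp: c_def B_def inv_into_f_f[OF inj])
      have cv: "(\<lambda>i\<in>{..<k}. c (b i)) = v"
        by (rule free_mod_eqI[OF _ v(1)])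
           (use ci free_mod_memD[OF v(1)] in \<open>auto intro!: restrict_in_free_mod\<close>)
      show "\<exists>!c. c \<in> B \<rightarrow>\<^sub>E carrier R \<and> finite {b\<in>B. c b \<noteq> \<zero>} \<and>
          x = (\<Oplus>\<^bsub>M\<^esub>b\<in>{b\<in>B. c b \<noteq> \<zero>}. c b \<odot>\<^bsub>M\<^esub> b)"
      proof (rule ex1I[of _ c])
        show "c \<in> B \<rightarrow>\<^sub>E carrier R \<and> finite {b\<in>B. c b \<noteq> \<zero>} \<and>
            x = (\<Oplus>\<^bsub>M\<^esub>b\<in>{b\<in>B. c b \<noteq> \<zero>}. c b \<odot>\<^bsub>M\<^esub> b)"
          using c sum[OF c] cv v by (auto simp: B_def)
      next
        fix c' assume "c' \<in> B \<rightarrow>\<^sub>E carrier R \<and> finite {b\<in>B. c' b \<noteq> \<zero>} \<and>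
            x = (\<Oplus>\<^bsub>M\<^esub>b\<in>{b\<in>B. c' b \<noteq> \<zero>}. c' b \<odot>\<^bsub>M\<^esub> b)"
        then have c': "c' \<in> B \<rightarrow>\<^sub>E carrier R" and "x = \<psi> (\<lambda>i\<in>{..<k}. c' (b i))"
          using sum by auto
        moreover have "(\<lambda>i\<in>{..<k}. c' (b i)) \<in> carrier (free_mod R k)"
          using c' by (intro restrict_in_free_mod) (auto simp: B_def)
        ultimately have "(\<lambda>i\<in>{..<k}. c' (b i)) = v"
          using v bij by (auto simp: bij_betw_def dest: inj_onD)
        then have "c' (b i) = v i" if "i < k" for i using that by (metis lessThan_iff restrict_apply')
        then show "c' = c" using ci by (intro PiE_ext[OF c' c]) (auto simp: B_def)
      qed
    qed
    then show ?thesis unfolding is_free_def by blast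
  qed
qed

text \<open>The last coordinate of \<open>M \<oplus> R^(m+1)\<close> is a linear form on \<open>R\<^sup>n\<close>, hence given by a row, which is
  unimodular because the form is onto.  Its kernel is isomorphic to \<open>M \<oplus> R\<^sup>m\<close> and free, so that the
  induction continues with a smaller \<open>m\<close>.\<close>

lemma free_complement_cancel:
  assumes rows: "\<And>n f. unimodular_row R n f \<Longrightarrow> has_free_kernel R n f"
    and "module R M" and "\<phi> \<in> module_iso R (free_mod R n) (direct_sum M (free_mod R m))"
  shows "\<exists>k. module_iso R (free_mod R k) M \<noteq> {}"
  using assms(3)
proof (induction m arbitrary: n \<phi>)
  case 0
  have "fst \<in> module_iso R (direct_sum M (free_mod R 0)) M"
  proof (rule module_isoI)
    have "carrier (free_mod R 0) = {\<lambda>_. undefined}" by (simp add: carrier_free_mod)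
    then show "bij_betw fst (carrier (direct_sum M (free_mod R 0))) (carrier M)"
      by (auto simp: direct_sum_def bij_betw_def inj_on_def)
  qed (auto simp: direct_sum_def)
  then show ?case using module_iso_comp[OF 0] by blast
next
  case (Suc m)
  interpret M: module R M by fact
  let ?N = "direct_sum M (free_mod R (Suc m))"
  have bij: "bij_betw \<phi> (carrier (free_mod R n)) (carrier ?N)"
    and add: "\<And>u v. u \<in> carrier (free_mod R n) \<Longrightarrow> v \<in> carrier (free_mod R n) \<Longrightarrow>
      \<phi> (u \<oplus>\<^bsub>free_mod R n\<^esub> v) = \<phi> u \<oplus>\<^bsub>?N\<^esub> \<phi> v"
    and smult: "\<And>a v. a \<in> carrier R \<Longrightarrow> v \<in> carrier (free_mod R n) \<Longrightarrow>
      \<phi> (a \<odot>\<^bsub>free_mod R n\<^esub> v) = a \<odot>\<^bsub>?N\<^esub> \<phi> v"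
    using Suc.prems by (auto simp: module_iso_def)
  have closed: "\<phi> v \<in> carrier ?N" if "v \<in> carrier (free_mod R n)" for v
    using bij that by (rule bij_betwE[rule_format])
  have snd_closed: "snd (\<phi> v) \<in> carrier (free_mod R (Suc m))" if "v \<in> carrier (free_mod R n)" for v
    using closed[OF that] by (auto simp: direct_sum_def)
  define l where "l v = snd (\<phi> v) m" for v
  define f where "f i = l (unit_vec R n i)" for i
  have lc: "l v \<in> carrier R" if "v \<in> carrier (free_mod R n)" for v
    unfolding l_def using snd_closed[OF that] by (rule free_mod_memD) simp
  have f: "f \<in> {..<n} \<rightarrow> carrier R" using lc unit_vec_closed by (auto simp: f_def)
  have l: "l v = row_pairing R n f v" if v: "v \<in> carrier (free_mod R n)" for v
  proof -
    have "l v = (\<Oplus>\<^bsub>self_mod R\<^esub>i\<in>{..<n}. v i \<odot>\<^bsub>self_mod R\<^esub> l (unit_vec R n i))"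
    proof (rule linear_eq_sum[OF module_self_mod _ _ _ v])
      show "l v \<in> carrier (self_mod R)" if "v \<in> carrier (free_mod R n)" for v
        using lc[OF that] by (simp add: self_mod_def)
      show "l (u \<oplus>\<^bsub>free_mod R n\<^esub> v) = l u \<oplus>\<^bsub>self_mod R\<^esub> l v"
        if "u \<in> carrier (free_mod R n)" "v \<in> carrier (free_mod R n)" for u v
        using add[OF that] by (simp add: l_def self_mod_def direct_sum_def add_free_mod)
      show "l (a \<odot>\<^bsub>free_mod R n\<^esub> v) = a \<odot>\<^bsub>self_mod R\<^esub> l v"
        if "a \<in> carrier R" "v \<in> carrier (free_mod R n)" for a v
        using smult[OF that] by (simp add: l_def self_mod_def direct_sum_def smult_free_mod)
    qed
    also have "\<dots> = (\<Oplus>\<^bsub>self_mod R\<^esub>i\<in>{..<n}. v i \<otimes> f i)" by (simp add: f_def self_mod_def)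
    also have "\<dots> = (\<Oplus>i\<in>{..<n}. v i \<otimes> f i)"
      using f free_mod_memD[OF v] by (intro finsum_self_mod) (auto simp: Pi_def)
    also have "\<dots> = row_pairing R n f v" unfolding row_pairing_def
      by (rule finsum_cong') (use f free_mod_memD[OF v] in \<open>auto simp: m_comm Pi_def\<close>)
    finally show ?thesis .
  qed
  have "unimodular_row R n f"
  proof -
    have "(\<zero>\<^bsub>M\<^esub>, unit_vec R (Suc m) m) \<in> carrier ?N"
      using unit_vec_closed by (auto simp: direct_sum_def)
    then have "(\<zero>\<^bsub>M\<^esub>, unit_vec R (Suc m) m) \<in> \<phi> ` carrier (free_mod R n)"
      using bij_betw_imp_surj_on[OF bij] by simp
    then obtain g where g: "g \<in> carrier (free_mod R n)" "\<phi> g = (\<zero>\<^bsub>M\<^esub>, unit_vec R (Suc m) m)"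
      by (metis imageE)
    then have "row_pairing R n f g = \<one>" using l[OF g(1)] by (simp add: l_def unit_vec_def)
    then show ?thesis using f g by (auto simp: unimodular_row_def)
  qed
  then obtain k \<tau> where \<tau>: "\<tau> \<in> module_iso R (free_mod R k) (row_kernel R n f)"
    using rows unfolding has_free_kernel_def by blast
  define \<rho> where "\<rho> x = (fst x, \<lambda>i\<in>{..<m}. snd x i)" for x :: "'c \<times> (nat \<Rightarrow> 'a)"
  have "\<rho> \<circ> \<phi> \<in> module_iso R (row_kernel R n f) (direct_sum M (free_mod R m))"
  proof (rule module_isoI)
    let ?K = "{x \<in> carrier ?N. snd x m = \<zero>}"
    have "bij_betw \<phi> (carrier (row_kernel R n f)) ?K"
      unfolding bij_betw_def
    proof
      show "inj_on \<phi> (carrier (row_kernel R n f))"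
        by (rule inj_on_subset[of _ "carrier (free_mod R n)"])
           (use bij in \<open>auto simp: bij_betw_def row_kernel_simps\<close>)
      have "\<phi> v \<in> ?K" if "v \<in> carrier (row_kernel R n f)" for v
        using that closed l by (auto simp: row_kernel_simps l_def)
      moreover have "x \<in> \<phi> ` carrier (row_kernel R n f)" if x: "x \<in> ?K" for x
      proof -
        have "x \<in> \<phi> ` carrier (free_mod R n)" using x bij_betw_imp_surj_on[OF bij] by simp
        then obtain v where v: "v \<in> carrier (free_mod R n)" "\<phi> v = x" by blast
        then have "v \<in> carrier (row_kernel R n f)" using x l[OF v(1)]
          by (auto simp: row_kernel_simps l_def)
        then show ?thesis using v by blast
      qed
      ultimately show "\<phi> ` carrier (row_kernel R n f) = ?K" by blast
    qed
    moreover have "bij_betw \<rho> ?K (carrier (direct_sum M (free_mod R m)))"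
    proof (rule bij_betw_byWitness[of _ "\<lambda>x. (fst x, \<lambda>i\<in>{..<Suc m}. if i < m then snd x i else \<zero>)"])
      show "\<forall>x\<in>?K. (fst (\<rho> x), \<lambda>i\<in>{..<Suc m}. if i < m then snd (\<rho> x) i else \<zero>) = x"
      proof
        fix x assume x: "x \<in> ?K"
        then have sx: "snd x \<in> carrier (free_mod R (Suc m))" by (auto simp: direct_sum_def)
        have "(\<lambda>i\<in>{..<Suc m}. if i < m then snd (\<rho> x) i else \<zero>) = snd x"
        proof (rule free_mod_eqI[OF _ sx])
          show "(\<lambda>i\<in>{..<Suc m}. if i < m then snd (\<rho> x) i else \<zero>) \<in> carrier (free_mod R (Suc m))"
            using free_mod_memD[OF sx] by (intro restrict_in_free_mod) (auto simp: \<rho>_def)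
          fix i assume "i < Suc m"
          then show "(\<lambda>i\<in>{..<Suc m}. if i < m then snd (\<rho> x) i else \<zero>) i = snd x i"
            using x by (cases "i = m") (auto simp: \<rho>_def)
        qed
        then show "(fst (\<rho> x), \<lambda>i\<in>{..<Suc m}. if i < m then snd (\<rho> x) i else \<zero>) = x"
          by (simp add: \<rho>_def)
      qed
      show "\<forall>x\<in>carrier (direct_sum M (free_mod R m)).
          \<rho> (fst x, \<lambda>i\<in>{..<Suc m}. if i < m then snd x i else \<zero>) = x"
      proof
        fix x assume "x \<in> carrier (direct_sum M (free_mod R m))"
        then have sx: "snd x \<in> carrier (free_mod R m)" by (auto simp: direct_sum_def)
        have "(\<lambda>i\<in>{..<m}. (\<lambda>i\<in>{..<Suc m}. if i < m then snd x i else \<zero>) i) = snd x"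
          by (rule free_mod_eqI[OF _ sx])
             (use free_mod_memD[OF sx] in \<open>auto intro!: restrict_in_free_mod\<close>)
        then show "\<rho> (fst x, \<lambda>i\<in>{..<Suc m}. if i < m then snd x i else \<zero>) = x"
          by (simp add: \<rho>_def)
      qed
      show "\<rho> ` ?K \<subseteq> carrier (direct_sum M (free_mod R m))"
        by (auto simp: \<rho>_def direct_sum_def intro!: restrict_in_free_mod intro: free_mod_memD[where n = "Suc m"])
      show "(\<lambda>x. (fst x, \<lambda>i\<in>{..<Suc m}. if i < m then snd x i else \<zero>)) `
          carrier (direct_sum M (free_mod R m)) \<subseteq> ?K"
        by (auto simp: direct_sum_def intro!: restrict_in_free_mod dest: free_mod_memD)
    qed
    ultimately show "bij_betw (\<rho> \<circ> \<phi>) (carrier (row_kernel R n f)) (carrier (direct_sum M (free_mod R m)))"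
      by (rule bij_betw_trans)
  next
    fix u v assume "u \<in> carrier (row_kernel R n f)" "v \<in> carrier (row_kernel R n f)"
    then have "\<phi> (u \<oplus>\<^bsub>free_mod R n\<^esub> v) = \<phi> u \<oplus>\<^bsub>?N\<^esub> \<phi> v" using add by (auto simp: row_kernel_simps)
    then show "(\<rho> \<circ> \<phi>) (u \<oplus>\<^bsub>row_kernel R n f\<^esub> v) =
        (\<rho> \<circ> \<phi>) u \<oplus>\<^bsub>direct_sum M (free_mod R m)\<^esub> (\<rho> \<circ> \<phi>) v"
      by (auto simp: row_kernel_simps \<rho>_def direct_sum_def add_free_mod intro!: restrict_ext)
  next
    fix a v assume "a \<in> carrier R" "v \<in> carrier (row_kernel R n f)"
    then have "\<phi> (a \<odot>\<^bsub>free_mod R n\<^esub> v) = a \<odot>\<^bsub>?N\<^esub> \<phi> v" using smult by (auto simp: row_kernel_simps)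
    then show "(\<rho> \<circ> \<phi>) (a \<odot>\<^bsub>row_kernel R n f\<^esub> v) =
        a \<odot>\<^bsub>direct_sum M (free_mod R m)\<^esub> (\<rho> \<circ> \<phi>) v"
      by (auto simp: row_kernel_simps \<rho>_def direct_sum_def smult_free_mod intro!: restrict_ext)
  qed
  then show ?case using module_iso_comp[OF \<tau>] Suc.IH by blast
qed

lemma hermite_ring_of_free_kernels:
  assumes rows: "\<And>n f. unimodular_row R n f \<Longrightarrow> has_free_kernel R n f"
  shows "hermite_ring TYPE('m) R"
  unfolding hermite_ring_def
proof (intro conjI allI impI)
  show "cring R" by (rule cring_axioms)
  fix M :: "('a, 'm) module"
  assume M: "module R M \<and> finitely_generated R M \<and> stably_free R M"
  then obtain m n \<phi> where \<phi>: "\<phi> \<in> module_iso R (direct_sum M (free_mod R m)) (free_mod R n)"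
    unfolding stably_free_def by blast
  have "module R (direct_sum M (free_mod R m))"
    using M by (intro module_direct_sum module_free_mod cring_axioms) auto
  then have "inv_into (carrier (direct_sum M (free_mod R m))) \<phi>
      \<in> module_iso R (free_mod R n) (direct_sum M (free_mod R m))"
    using \<phi> by (rule module_iso_inv)
  then obtain k \<psi> where "\<psi> \<in> module_iso R (free_mod R k) M"
    using free_complement_cancel[OF rows] M by blast
  then show "is_free R M" using M is_free_of_iso by blast
qed

end

section \<open>Congruences modulo an ideal\<close>

lemma (in ideal) congruent_finsum:
  assumes "finite A" "\<And>i. i \<in> A \<Longrightarrow> x i \<in> carrier R" "\<And>i. i \<in> A \<Longrightarrow> y i \<in> carrier R"
    and "\<And>i. i \<in> A \<Longrightarrow> x i \<ominus> y i \<in> I"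
  shows "(\<Oplus>i\<in>A. x i) \<ominus> (\<Oplus>i\<in>A. y i) \<in> I"
  using assms
proof (induction A)
  case empty
  then show ?case by (simp add: a_minus_def)
next
  case (insert j A)
  define X where "X = (\<Oplus>i\<in>A. x i)"
  define Y where "Y = (\<Oplus>i\<in>A. y i)"
  have cr: "x j \<in> carrier R" "y j \<in> carrier R" "X \<in> carrier R" "Y \<in> carrier R"
    using insert.prems by (auto simp: X_def Y_def intro!: finsum_closed)
  have "(\<Oplus>i\<in>insert j A. x i) = x j \<oplus> X" "(\<Oplus>i\<in>insert j A. y i) = y j \<oplus> Y"
    using insert unfolding X_def Y_def by (auto simp: Pi_def)
  moreover have "(x j \<oplus> X) \<ominus> (y j \<oplus> Y) = (x j \<ominus> y j) \<oplus> (X \<ominus> Y)"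
    using cr by algebra
  moreover have "X \<ominus> Y \<in> I" using insert unfolding X_def Y_def by auto
  ultimately show ?case using insert.prems by auto
qed

context cring
begin

text \<open>Modulo \<open>I\<close> the element \<open>k\<close> is an inverse of \<open>h\<close>, so powers of \<open>h\<close> can be cancelled.\<close>

lemma ideal_cancel_unit_mod:
  assumes "ideal I R" and cr: "y \<in> carrier R" "h \<in> carrier R" "k \<in> carrier R"
    and hk: "h \<otimes> k \<ominus> \<one> \<in> I" and "y \<otimes> h [^] (d::nat) \<in> I"
  shows "y \<in> I"
  using assms(6)
proof (induction d)
  case 0
  then show ?case using cr by simp
next
  case (Suc d)
  interpret ideal I R by fact
  define e where "e = y \<otimes> h [^] d"
  have e: "e \<in> carrier R" using cr by (simp add: e_def)
  have "e \<otimes> h \<in> I" using Suc.prems cr by (simp add: e_def m_assoc)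
  then have "k \<otimes> (e \<otimes> h) \<oplus> \<ominus> (e \<otimes> (h \<otimes> k \<ominus> \<one>)) \<in> I"
    using hk cr e by (simp add: I_l_closed)
  moreover have "k \<otimes> (e \<otimes> h) \<oplus> \<ominus> (e \<otimes> (h \<otimes> k \<ominus> \<one>)) = e" using cr e by algebra
  ultimately show ?case using Suc.IH by (simp add: e_def)
qed

lemma ideal_congruent_pow:
  assumes "ideal I R" "x \<in> carrier R" "y \<in> carrier R" "x \<ominus> y \<in> I"
  shows "x [^] (i::nat) \<ominus> y [^] i \<in> I"
proof (induction i)
  interpret ideal I R by fact
  case 0
  show ?case by (simp add: a_minus_def r_neg)
next
  interpret ideal I R by fact
  case (Suc i)
  define X where "X = x [^] i"
  define Y where "Y = y [^] i"
  have cr: "X \<in> carrier R" "Y \<in> carrier R" using assms by (simp_all add: X_def Y_def)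
  have "x \<otimes> (X \<ominus> Y) \<oplus> Y \<otimes> (x \<ominus> y) \<in> I"
    using Suc assms cr by (simp add: X_def Y_def I_l_closed)
  moreover have "x \<otimes> (X \<ominus> Y) \<oplus> Y \<otimes> (x \<ominus> y) = X \<otimes> x \<ominus> Y \<otimes> y" using cr assms(2,3) by algebra
  ultimately show ?case by (simp add: X_def Y_def)
qed

text \<open>Modulo \<open>I\<close>, substituting \<open>f = t h\<close> turns the binary form of degree \<open>d\<close> with coefficients
  \<open>c\<close> into \<open>h^d\<close> times its dehomogenization at \<open>t\<close>.\<close>

lemma ideal_dehomogenize:
  assumes "ideal I R"
    and cr: "f \<in> carrier R" "h \<in> carrier R" "t \<in> carrier R" "k \<in> carrier R"
    and c: "\<And>i::nat. i \<le> d \<Longrightarrow> c i \<in> carrier R"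
    and ft: "f \<ominus> t \<otimes> h \<in> I" and hk: "h \<otimes> k \<ominus> \<one> \<in> I"
    and form: "(\<Oplus>i\<in>{..d}. c i \<otimes> (f [^] i \<otimes> h [^] (d - i))) \<in> I"
  shows "(\<Oplus>i\<in>{..d}. c i \<otimes> t [^] i) \<in> I"
proof -
  interpret ideal I R by fact
  define X where "X = (\<Oplus>i\<in>{..d}. c i \<otimes> (f [^] i \<otimes> h [^] (d - i)))"
  define S where "S = (\<Oplus>i\<in>{..d}. c i \<otimes> t [^] i)"
  have Sc: "S \<in> carrier R" unfolding S_def using c cr by (intro finsum_closed) auto
  have Xc: "X \<in> carrier R" unfolding X_def using c cr by (intro finsum_closed) auto
  have "X \<ominus> (\<Oplus>i\<in>{..d}. (c i \<otimes> t [^] i) \<otimes> h [^] d) \<in> I"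
    unfolding X_def
  proof (rule congruent_finsum)
    fix i assume i: "i \<in> {..d}"
    define F where "F = f [^] i"
    define T where "T = t [^] i"
    define H where "H = h [^] i"
    define H' where "H' = h [^] (d - i)"
    have cr': "F \<in> carrier R" "T \<in> carrier R" "H \<in> carrier R" "H' \<in> carrier R" "c i \<in> carrier R"
      using cr c i by (simp_all add: F_def T_def H_def H'_def)
    have "F \<ominus> T \<otimes> H \<in> I"
      using ideal_congruent_pow[OF assms(1) _ _ ft, of i] cr
      by (simp add: F_def T_def H_def nat_pow_distrib)
    then have "(c i \<otimes> H') \<otimes> (F \<ominus> T \<otimes> H) \<in> I" using cr' by (simp add: I_l_closed)
    moreover have "(c i \<otimes> H') \<otimes> (F \<ominus> T \<otimes> H) = c i \<otimes> (F \<otimes> H') \<ominus> (c i \<otimes> T) \<otimes> (H \<otimes> H')"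
      using cr' by algebra
    moreover have "H \<otimes> H' = h [^] d"
      using i cr by (simp add: H_def H'_def nat_pow_mult)
    ultimately show "c i \<otimes> (f [^] i \<otimes> h [^] (d - i)) \<ominus> (c i \<otimes> t [^] i) \<otimes> h [^] d \<in> I"
      by (simp add: F_def T_def H'_def)
  qed (use c cr in auto)
  also have "(\<Oplus>i\<in>{..d}. (c i \<otimes> t [^] i) \<otimes> h [^] d) = S \<otimes> h [^] d"
    unfolding S_def by (rule finsum_ldistr[symmetric]) (use c cr in auto)
  finally have "X \<oplus> \<ominus> (X \<ominus> S \<otimes> h [^] d) \<in> I" using form unfolding X_def by simp
  moreover have "h [^] d \<in> carrier R" using cr by simp
  then have "X \<oplus> \<ominus> (X \<ominus> S \<otimes> h [^] d) = S \<otimes> h [^] d" using Xc Sc by algebra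
  ultimately have "S \<otimes> h [^] d \<in> I" by simp
  then show ?thesis using ideal_cancel_unit_mod[OF assms(1) Sc cr(2,4) hk] by (simp add: S_def)
qed

text \<open>An element congruent to a unit modulo \<open>a\<close> is a unit modulo each power of \<open>a\<close>: the exponent of
  a power of \<open>a\<close> in \<open>I\<close> can be lowered step by step.\<close>

lemma ideal_one_of_power:
  assumes "ideal I R" and cr: "a \<in> carrier R" "u \<in> carrier R" "v \<in> carrier R" "z \<in> carrier R"
    and uv: "u \<otimes> v = \<one>" and "u \<oplus> a \<otimes> z \<in> I" and "a [^] (n::nat) \<in> I"
  shows "\<one> \<in> I"
  using assms(8)
proof (induction n)
  case 0
  then show ?case by simp
next
  case (Suc n)
  interpret ideal I R by fact
  define e where "e = a [^] n"
  have e: "e \<in> carrier R" using cr by (simp add: e_def)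
  have "e \<otimes> a \<in> I" using Suc.prems by (simp add: e_def)
  then have "v \<otimes> (e \<otimes> (u \<oplus> a \<otimes> z) \<oplus> \<ominus> (z \<otimes> (e \<otimes> a))) \<in> I"
    using assms(7) cr e by (simp add: I_l_closed)
  moreover have "v \<otimes> (e \<otimes> (u \<oplus> a \<otimes> z) \<oplus> \<ominus> (z \<otimes> (e \<otimes> a))) = (u \<otimes> v) \<otimes> e" using cr e by algebra
  ultimately show ?case using Suc.IH uv e by (simp add: e_def)
qed

definition ideal2 :: "'a \<Rightarrow> 'a \<Rightarrow> 'a set" where
  "ideal2 x y = {r \<otimes> x \<oplus> s \<otimes> y |r s. r \<in> carrier R \<and> s \<in> carrier R}"

lemma ideal_ideal2:
  assumes cr: "x \<in> carrier R" "y \<in> carrier R"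
  shows "ideal (ideal2 x y) R"
proof -
  have "ideal2 x y = PIdl x <+> PIdl y"
    by (auto simp: ideal2_def cgenideal_def set_add_def')
  then show ?thesis using add_ideals cgenideal_ideal cr by simp
qed

lemma ideal2I: "r \<in> carrier R \<Longrightarrow> s \<in> carrier R \<Longrightarrow> z = r \<otimes> x \<oplus> s \<otimes> y \<Longrightarrow> z \<in> ideal2 x y"
  by (auto simp: ideal2_def)

lemma ideal2E:
  assumes "z \<in> ideal2 x y"
  obtains r s where "r \<in> carrier R" "s \<in> carrier R" "z = r \<otimes> x \<oplus> s \<otimes> y"
  using assms by (auto simp: ideal2_def)

end

context cring
begin

text \<open>A combination of the two comaximal entries can replace the third entry by \<open>1\<close>.\<close>

lemma has_free_kernel_of_unimodular_pair:
  assumes f: "f \<in> {..<n} \<rightarrow> carrier R" and ij: "i < n" "j < n" "i \<noteq> j"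
    and l: "l < n" "l \<noteq> i" "l \<noteq> j" and one: "\<one> \<in> ideal2 (f i) (f j)"
  shows "has_free_kernel R n f"
proof -
  obtain x y where xy: "x \<in> carrier R" "y \<in> carrier R" "\<one> = x \<otimes> f i \<oplus> y \<otimes> f j"
    using one by (rule ideal2E)
  have fc: "f i \<in> carrier R" "f j \<in> carrier R" "f l \<in> carrier R" using f ij l by auto
  define q where "q = \<one> \<ominus> f l"
  have q: "q \<in> carrier R" using fc by (simp add: q_def)
  define f1 where "f1 = f(l := f l \<oplus> (q \<otimes> x) \<otimes> f i)"
  have f1: "f1 \<in> {..<n} \<rightarrow> carrier R" using f fc q xy by (auto simp: f1_def)
  define f2 where "f2 = f1(l := f1 l \<oplus> (q \<otimes> y) \<otimes> f1 j)"
  have f2: "f2 \<in> {..<n} \<rightarrow> carrier R" using f fc q xy l by (auto simp: f2_def f1_def)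
  have "f2 l = (f l \<oplus> (q \<otimes> x) \<otimes> f i) \<oplus> (q \<otimes> y) \<otimes> f j" using l by (simp add: f2_def f1_def)
  also have "\<dots> = f l \<oplus> q \<otimes> (x \<otimes> f i \<oplus> y \<otimes> f j)" using fc q xy(1,2) by algebra
  also have "\<dots> = f l \<oplus> q \<otimes> \<one>" using xy(3) by simp
  also have "\<dots> = \<one>" unfolding q_def using fc by algebra
  finally have "has_free_kernel R n f2" using has_free_kernel_unit[OF f2 l(1)] by simp
  then have "has_free_kernel R n f1"
    using has_free_kernel_add_multiple[OF f1, of "q \<otimes> y" l j] q xy ij l by (simp add: f2_def)
  then show ?thesis
    using has_free_kernel_add_multiple[OF f, of "q \<otimes> x" l i] q xy ij l by (simp add: f1_def)
qed

end

section \<open>Linear algebra over valuation rings\<close>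

text \<open>In the zero ring the element \<open>0\<close> is a unit and the nonunits do not form an ideal; it is excluded
  here.\<close>

locale valuation_nontrivial = cring R for R (structure) +
  assumes total: "\<lbrakk>a \<in> carrier R; b \<in> carrier R\<rbrakk> \<Longrightarrow> a divides b \<or> b divides a"
    and one_not_zero: "\<one> \<noteq> \<zero>"
begin

definition nonunits :: "'a set" where
  "nonunits = carrier R - Units R"

lemma nonunits_closed [simp]: "a \<in> nonunits \<Longrightarrow> a \<in> carrier R"
  by (simp add: nonunits_def)

lemma zero_nonunit [simp]: "\<zero> \<in> nonunits"
proof -
  have "\<zero> \<notin> Units R"
  proof
    assume "\<zero> \<in> Units R"
    then obtain b where "b \<in> carrier R" "\<zero> \<otimes> b = \<one>"
      by (metis Units_closed Units_inv_closed Units_r_inv)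
    then show False using one_not_zero by simp
  qed
  then show ?thesis by (simp add: nonunits_def)
qed

lemma nonunits_mult:
  assumes "a \<in> nonunits" "b \<in> carrier R"
  shows "a \<otimes> b \<in> nonunits"
proof -
  have "a \<in> carrier R" "a \<notin> Units R" using assms by (simp_all add: nonunits_def)
  then show ?thesis using unit_factor[of a b] assms(2) by (auto simp: nonunits_def)
qed

lemma nonunits_mult_left:
  assumes "a \<in> nonunits" "b \<in> carrier R"
  shows "b \<otimes> a \<in> nonunits"
  using nonunits_mult[OF assms] assms m_comm by simp

text \<open>Valuation rings are local: if \<open>a\<close> divides \<open>b\<close>, then it divides \<open>a \<oplus> b\<close>, which is therefore
  a nonunit along with \<open>a\<close>.\<close>

lemma nonunits_add:
  assumes "a \<in> nonunits" "b \<in> nonunits"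
  shows "a \<oplus> b \<in> nonunits"
proof -
  have cr [simp]: "a \<in> carrier R" "b \<in> carrier R" using assms by simp_all
  have "a divides b \<or> b divides a" using total cr by blast
  then show ?thesis
  proof
    assume "a divides b"
    then obtain c where c: "c \<in> carrier R" "b = a \<otimes> c" by (auto simp: factor_def)
    then have "a \<oplus> b = a \<otimes> (\<one> \<oplus> c)" by (simp add: r_distr)
    then show ?thesis using nonunits_mult[OF assms(1)] c by simp
  next
    assume "b divides a"
    then obtain c where c: "c \<in> carrier R" "a = b \<otimes> c" by (auto simp: factor_def)
    then have "a \<oplus> b = b \<otimes> (c \<oplus> \<one>)" by (simp add: r_distr)
    then show ?thesis using nonunits_mult[OF assms(2)] c by simp
  qed
qed

lemma nonunits_minus: "a \<in> nonunits \<Longrightarrow> \<ominus> a \<in> nonunits"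
  using nonunits_mult[of a "\<ominus> \<one>"] by (simp add: r_minus)

lemma nonunits_finsum:
  assumes "finite A" "\<And>i. i \<in> A \<Longrightarrow> f i \<in> nonunits"
  shows "(\<Oplus>i\<in>A. f i) \<in> nonunits"
  using assms by (induction A) (auto simp: Pi_def nonunits_add)

lemma unit_not_nonunit: "a \<in> Units R \<Longrightarrow> a \<notin> nonunits"
  by (simp add: nonunits_def)

lemma unit_add_nonunit:
  assumes "u \<in> Units R" "a \<in> nonunits"
  shows "u \<oplus> a \<in> Units R"
proof (rule ccontr)
  have cr [simp]: "u \<in> carrier R" "a \<in> carrier R" using assms by (simp_all add: Units_closed)
  assume "u \<oplus> a \<notin> Units R"
  then have "u \<oplus> a \<in> nonunits" by (simp add: nonunits_def)
  then have "(u \<oplus> a) \<oplus> (\<ominus> a) \<in> nonunits" using assms nonunits_add nonunits_minus by blast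
  moreover have "(u \<oplus> a) \<oplus> (\<ominus> a) = u" using cr by algebra
  ultimately show False using assms unit_not_nonunit by simp
qed

lemma exists_common_divisor:
  assumes "finite I" "I \<noteq> {}" "\<And>i. i \<in> I \<Longrightarrow> e i \<in> carrier R"
  shows "\<exists>k\<in>I. \<forall>i\<in>I. e k divides e i"
  using assms
proof (induction I rule: finite_ne_induct)
  case (singleton i)
  then show ?case by simp
next
  case (insert j I)
  then obtain k where k: "k \<in> I" "\<forall>i\<in>I. e k divides e i" by auto
  have "e j divides e k \<or> e k divides e j" using total insert.prems k(1) by blast
  then show ?case
  proof
    assume "e j divides e k"
    then have "\<forall>i\<in>insert j I. e j divides e i"
      using k insert.prems by (auto intro: divides_trans[of "e j" "e k"])
    then show ?thesis by blast
  next
    assume "e k divides e j"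
    then show ?thesis using k by blast
  qed
qed

text \<open>More vectors than coordinates: Gaussian elimination works over a valuation ring, with an entry
  that divides all other entries of its column as the pivot.  A relation between the reduced vectors
  extends to the pivot vector, and its unit coefficient survives.  This replaces the linear
  dependence over a field of fractions with denominators cleared.\<close>

lemma exists_unimodular_relation:
  assumes "finite I" "N < card I"
    and "\<And>i k. i \<in> I \<Longrightarrow> k < N \<Longrightarrow> w i k \<in> carrier R"
  shows "\<exists>c. (\<forall>i\<in>I. c i \<in> carrier R) \<and> (\<exists>i\<in>I. c i \<in> Units R) \<and>
           (\<forall>k<N. (\<Oplus>i\<in>I. c i \<otimes> w i k) = \<zero>)"
  using assms
proof (induction N arbitrary: I w)
  case 0
  then have "I \<noteq> {}" by auto
  then show ?case by (intro exI[of _ "\<lambda>_. \<one>"]) auto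
next
  case (Suc N)
  have "I \<noteq> {}" using Suc.prems by auto
  then obtain p where p: "p \<in> I" "\<forall>i\<in>I. w p N divides w i N"
    using exists_common_divisor[of I "\<lambda>i. w i N"] Suc.prems by auto
  then have "\<forall>i\<in>I. \<exists>q\<in>carrier R. w i N = w p N \<otimes> q" by (auto simp: factor_def)
  then obtain q where q: "\<And>i. i \<in> I \<Longrightarrow> q i \<in> carrier R" "\<And>i. i \<in> I \<Longrightarrow> w i N = w p N \<otimes> q i"
    by metis
  let ?J = "I - {p}"
  have fin: "finite ?J" using Suc.prems by simp
  have I: "I = insert p ?J" using p by auto
  have wc: "w i k \<in> carrier R" if "i \<in> I" "k < Suc N" for i k using Suc.prems(3) that by simp
  define w' where "w' i k = w i k \<ominus> q i \<otimes> w p k" for i k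
  have "\<exists>c. (\<forall>i\<in>?J. c i \<in> carrier R) \<and> (\<exists>i\<in>?J. c i \<in> Units R) \<and>
           (\<forall>k<N. (\<Oplus>i\<in>?J. c i \<otimes> w' i k) = \<zero>)"
  proof (rule Suc.IH)
    show "N < card ?J" using Suc.prems(1,2) p(1) by simp
    show "w' i k \<in> carrier R" if "i \<in> ?J" "k < N" for i k
      using that q(1) wc[of i k] wc[of p k] p(1) by (simp add: w'_def)
  qed (rule fin)
  then obtain c where c: "\<And>i. i \<in> ?J \<Longrightarrow> c i \<in> carrier R" "\<exists>i\<in>?J. c i \<in> Units R"
    "\<And>k. k < N \<Longrightarrow> (\<Oplus>i\<in>?J. c i \<otimes> w' i k) = \<zero>" by blast
  define s where "s = (\<Oplus>i\<in>?J. c i \<otimes> q i)"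
  define c' where "c' = c(p := \<ominus> s)"
  have s: "s \<in> carrier R" unfolding s_def using c q by (intro finsum_closed) auto
  have "(\<Oplus>i\<in>I. c' i \<otimes> w i k) = \<zero>" if k: "k < Suc N" for k
  proof -
    have wck: "\<And>i. i \<in> I \<Longrightarrow> w i k \<in> carrier R" using wc k by simp
    have split: "(\<Oplus>i\<in>?J. c i \<otimes> w' i k) = (\<Oplus>i\<in>?J. c i \<otimes> w i k) \<oplus> \<ominus> s \<otimes> w p k"
    proof -
      have "(\<Oplus>i\<in>?J. c i \<otimes> w i k) =
          (\<Oplus>i\<in>?J. c i \<otimes> w' i k \<oplus> (c i \<otimes> q i) \<otimes> w p k)"
      proof (rule finsum_cong')
        fix i assume i: "i \<in> ?J"
        have cr: "c i \<in> carrier R" "q i \<in> carrier R" "w i k \<in> carrier R" "w p k \<in> carrier R"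
          using i c(1) q(1) wck p by auto
        show "c i \<otimes> w i k = c i \<otimes> w' i k \<oplus> (c i \<otimes> q i) \<otimes> w p k"
          unfolding w'_def using cr by algebra
      qed (use c(1) q(1) wck p in \<open>auto simp: w'_def\<close>)
      also have "\<dots> = (\<Oplus>i\<in>?J. c i \<otimes> w' i k) \<oplus> (\<Oplus>i\<in>?J. (c i \<otimes> q i) \<otimes> w p k)"
        by (rule finsum_addf) (use c(1) q(1) wck p in \<open>auto simp: w'_def\<close>)
      also have "(\<Oplus>i\<in>?J. (c i \<otimes> q i) \<otimes> w p k) = s \<otimes> w p k"
        unfolding s_def by (subst finsum_ldistr) (use c(1) q(1) wck p fin in auto)
      finally have e: "(\<Oplus>i\<in>?J. c i \<otimes> w i k) = (\<Oplus>i\<in>?J. c i \<otimes> w' i k) \<oplus> s \<otimes> w p k" .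
      have cr: "(\<Oplus>i\<in>?J. c i \<otimes> w' i k) \<in> carrier R" "w p k \<in> carrier R"
        using c(1) q(1) wck p by (auto simp: w'_def intro!: finsum_closed)
      have "x = (x \<oplus> s \<otimes> y) \<oplus> \<ominus> s \<otimes> y" if "x \<in> carrier R" "y \<in> carrier R" for x y
        using that s by algebra
      then show ?thesis unfolding e using cr by blast
    qed
    have zero: "(\<Oplus>i\<in>?J. c i \<otimes> w' i k) = \<zero>"
    proof (cases "k < N")
      case False
      with k have "k = N" by simp
      have "w' i k = \<zero>" if "i \<in> ?J" for i
        using that p q wck unfolding w'_def \<open>k = N\<close>
        by (metis DiffD1 m_comm minus_eq r_neg)
      then show ?thesis using c(1) by (intro add.finprod_one_eqI) simp
    qed (simp add: c(3))
    have "(\<Oplus>i\<in>I. c' i \<otimes> w i k) = c' p \<otimes> w p k \<oplus> (\<Oplus>i\<in>?J. c' i \<otimes> w i k)"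
      by (subst I, rule finsum_insert) (use fin c(1) s wck p in \<open>auto simp: c'_def\<close>)
    also have "(\<Oplus>i\<in>?J. c' i \<otimes> w i k) = (\<Oplus>i\<in>?J. c i \<otimes> w i k)"
      by (rule finsum_cong') (use c(1) wck in \<open>auto simp: c'_def\<close>)
    also have "c' p \<otimes> w p k \<oplus> \<dots> = (\<Oplus>i\<in>?J. c i \<otimes> w' i k)"
      unfolding split using wck p c(1) s by (subst a_comm) (auto simp: c'_def intro!: finsum_closed)
    finally show ?thesis using zero by simp
  qed
  moreover have "\<forall>i\<in>I. c' i \<in> carrier R" "\<exists>i\<in>I. c' i \<in> Units R"
    using c s p by (auto simp: c'_def)
  ultimately show ?case by blast
qed

text \<open>Let \<open>i\<close> be the least index for which \<open>c i\<close> divides a power of \<open>a\<close>, say \<open>a^M\<close>, and put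
  \<open>t = a^(M+1)\<close>.  Then \<open>c i \<otimes> t^i\<close> dominates the sum: the coefficients before \<open>i\<close> are divisible by
  all powers of \<open>a\<close>, as divisibility is total, and the terms after \<open>i\<close> are divisible by \<open>t^(i+1)\<close>,
  hence by \<open>c i \<otimes> t^i \<otimes> a\<close>.  So the sum is \<open>c i \<otimes> t^i\<close> times an element \<open>\<one> \<oplus> a \<otimes> Z\<close>, which is a
  unit.  In terms of primes, for \<open>a\<close> not nilpotent: a polynomial that is nonzero modulo the
  largest prime ideal not containing \<open>a\<close> does not vanish modulo that prime at high powers of \<open>a\<close>.\<close>

lemma exists_power_value_divides_power:
  fixes c :: "nat \<Rightarrow> 'a"
  assumes c: "\<And>i. i \<le> d \<Longrightarrow> c i \<in> carrier R" and unit: "k \<le> d" "c k \<in> Units R"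
    and a: "a \<in> nonunits"
  shows "\<exists>M N. (\<Oplus>i\<in>{..d}. c i \<otimes> (a [^] Suc M) [^] i) divides (a [^] (N::nat))"
proof -
  have [simp]: "a \<in> carrier R" using a by simp
  let ?Q = "\<lambda>i. i \<le> d \<and> (\<exists>M::nat. c i divides a [^] M)"
  have "?Q k" using unit c by (auto intro!: exI[of _ 0] unit_divides)
  define i where "i = (LEAST i. ?Q i)"
  have Qi: "?Q i" unfolding i_def by (rule LeastI) fact
  have least: "\<not> ?Q j" if "j < i" for j using that unfolding i_def by (rule not_less_Least)
  from Qi obtain M :: nat and s where s: "s \<in> carrier R" "a [^] M = c i \<otimes> s"
    by (auto simp: factor_def)
  have id: "i \<le> d" using Qi by simp
  have ci [simp]: "c i \<in> carrier R" using c id by simp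
  define t where "t = a [^] Suc M"
  have [simp]: "t \<in> carrier R" by (simp add: t_def)
  define e where "e = c i \<otimes> t [^] i"
  have [simp]: "e \<in> carrier R" by (simp add: e_def)
  have t: "t = c i \<otimes> (s \<otimes> a)" using s by (simp add: t_def m_assoc)
  have terms: "\<exists>z\<in>carrier R. c j \<otimes> t [^] j = e \<otimes> (a \<otimes> z)" if j: "j \<le> d" "j \<noteq> i" for j
  proof (cases "j < i")
    case True
    have cj [simp]: "c j \<in> carrier R" using c j by simp
    let ?n = "Suc M * i + Suc M"
    have "\<not> c j divides a [^] ?n" using least[OF True] j by blast
    then have "a [^] ?n divides c j" using total[of "a [^] ?n" "c j"] by auto
    then obtain z where z: "z \<in> carrier R" "c j = a [^] ?n \<otimes> z" by (auto simp: factor_def)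
    have "a [^] ?n = t [^] i \<otimes> t" by (simp only: t_def nat_pow_mult nat_pow_pow \<open>a \<in> carrier R\<close> nat_pow_closed)
    also have "\<dots> = e \<otimes> (s \<otimes> a)" using s(1) by (subst (2) t) (simp add: e_def m_ac)
    finally have an: "a [^] ?n = e \<otimes> (s \<otimes> a)" .
    have "e \<otimes> (s \<otimes> a) \<otimes> z \<otimes> y = e \<otimes> (a \<otimes> (s \<otimes> z \<otimes> y))" if "y \<in> carrier R" for y
      using that s(1) z(1) by (simp add: m_ac)
    then have "c j \<otimes> t [^] j = e \<otimes> (a \<otimes> (s \<otimes> z \<otimes> t [^] j))"
      unfolding z(2) an by simp
    then show ?thesis
      by (rule bexI[of _ "s \<otimes> z \<otimes> t [^] j"]) (use z(1) s(1) in simp)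
  next
    case False
    define r where "r = j - Suc i"
    have jr: "j = i + Suc r" using j False by (simp add: r_def)
    have "t [^] j = t [^] i \<otimes> (t \<otimes> t [^] r)"
      by (simp only: jr nat_pow_mult[symmetric] nat_pow_Suc2 \<open>t \<in> carrier R\<close>)
    also have "\<dots> = e \<otimes> (s \<otimes> a) \<otimes> t [^] r"
      using s(1) by (subst (2) t) (simp add: e_def m_ac)
    finally have "c j \<otimes> t [^] j = e \<otimes> (a \<otimes> (s \<otimes> t [^] r \<otimes> c j))"
      using s(1) c j by (simp add: m_ac)
    then show ?thesis
      by (rule bexI[of _ "s \<otimes> t [^] r \<otimes> c j"]) (use s(1) c[OF j(1)] in simp)
  qed
  then obtain z where z: "\<And>j. j \<le> d \<Longrightarrow> j \<noteq> i \<Longrightarrow> z j \<in> carrier R"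
    "\<And>j. j \<le> d \<Longrightarrow> j \<noteq> i \<Longrightarrow> c j \<otimes> t [^] j = e \<otimes> (a \<otimes> z j)" by metis
  define Z where "Z = (\<Oplus>j\<in>{..d} - {i}. z j)"
  have [simp]: "Z \<in> carrier R" unfolding Z_def using z by (intro finsum_closed) auto
  have "(\<Oplus>j\<in>{..d}. c j \<otimes> t [^] j) = (\<Oplus>j\<in>insert i ({..d} - {i}). c j \<otimes> t [^] j)"
    using id by (simp add: insert_absorb)
  also have "\<dots> = e \<oplus> (\<Oplus>j\<in>{..d} - {i}. c j \<otimes> t [^] j)"
    unfolding e_def by (rule finsum_insert) (use c id in auto)
  also have "(\<Oplus>j\<in>{..d} - {i}. c j \<otimes> t [^] j) = (\<Oplus>j\<in>{..d} - {i}. (e \<otimes> a) \<otimes> z j)"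
    by (rule finsum_cong') (use z in \<open>auto simp: m_assoc\<close>)
  also have "\<dots> = (e \<otimes> a) \<otimes> Z"
    unfolding Z_def by (rule finsum_rdistr[symmetric]) (use z in auto)
  also have "e \<oplus> (e \<otimes> a) \<otimes> Z = e \<otimes> (\<one> \<oplus> a \<otimes> Z)" by (simp add: r_distr m_assoc)
  finally have sum: "(\<Oplus>j\<in>{..d}. c j \<otimes> t [^] j) = e \<otimes> (\<one> \<oplus> a \<otimes> Z)" .
  define v where "v = inv (\<one> \<oplus> a \<otimes> Z)"
  have u: "\<one> \<oplus> a \<otimes> Z \<in> Units R" by (intro unit_add_nonunit nonunits_mult a) auto
  have v: "v \<in> carrier R" "(\<one> \<oplus> a \<otimes> Z) \<otimes> v = \<one>" using u by (auto simp: v_def)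
  have "a [^] (M + Suc M * i) = a [^] M \<otimes> t [^] i"
    by (simp only: t_def nat_pow_pow nat_pow_mult \<open>a \<in> carrier R\<close> nat_pow_closed)
  also have "\<dots> = e \<otimes> s"
    unfolding s(2) e_def using s(1) by (simp add: m_ac)
  also have "\<dots> = e \<otimes> ((\<one> \<oplus> a \<otimes> Z) \<otimes> v) \<otimes> s" using v by simp
  also have "\<dots> = (e \<otimes> (\<one> \<oplus> a \<otimes> Z)) \<otimes> (v \<otimes> s)" using v(1) s by (simp add: m_assoc)
  finally have "e \<otimes> (\<one> \<oplus> a \<otimes> Z) divides a [^] (M + Suc M * i)"
    using v s by (auto simp: factor_def)
  then show ?thesis using sum unfolding t_def by metis
qed

end

section \<open>Polynomials modulo the maximal ideal\<close>

locale valuation_UP = UP + R?: valuation_nontrivial R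

sublocale valuation_UP < UP_cring
  by intro_locales [1] (rule P_def)

context valuation_UP
begin

text \<open>The kernel of the reduction of coefficients modulo the maximal ideal.  Its complement consists of
  the primitive polynomials.\<close>

definition residually_zero :: "(nat \<Rightarrow> 'a) set" where
  "residually_zero = {p \<in> carrier P. \<forall>n. coeff P p n \<in> nonunits}"

lemma residually_zero_closed: "p \<in> residually_zero \<Longrightarrow> p \<in> carrier P"
  by (simp add: residually_zero_def)

lemma residually_zero_zero [simp]: "\<zero>\<^bsub>P\<^esub> \<in> residually_zero"
  by (simp add: residually_zero_def)

lemma residually_zero_add:
  "p \<in> residually_zero \<Longrightarrow> q \<in> residually_zero \<Longrightarrow> p \<oplus>\<^bsub>P\<^esub> q \<in> residually_zero"
  by (simp add: residually_zero_def nonunits_add)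

lemma residually_zero_minus: "p \<in> residually_zero \<Longrightarrow> \<ominus>\<^bsub>P\<^esub> p \<in> residually_zero"
  by (simp add: residually_zero_def nonunits_minus)

lemma residually_zero_mult:
  assumes "p \<in> residually_zero" "q \<in> carrier P"
  shows "p \<otimes>\<^bsub>P\<^esub> q \<in> residually_zero"
proof -
  have "p \<in> carrier P" "\<And>n. coeff P p n \<in> nonunits" using assms by (simp_all add: residually_zero_def)
  then show ?thesis using assms(2)
    by (simp add: residually_zero_def nonunits_finsum nonunits_mult)
qed

lemma residually_zero_mult_left:
  assumes "p \<in> residually_zero" "q \<in> carrier P"
  shows "q \<otimes>\<^bsub>P\<^esub> p \<in> residually_zero"
  using residually_zero_mult[OF assms] assms residually_zero_closed P.m_comm by metis

lemma residually_zero_finsum: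
  assumes "finite A" "\<And>i. i \<in> A \<Longrightarrow> f i \<in> residually_zero"
  shows "(\<Oplus>\<^bsub>P\<^esub>i\<in>A. f i) \<in> residually_zero"
  using assms by (induction A) (auto simp: Pi_def residually_zero_add residually_zero_closed)

lemma residually_zero_const: "a \<in> nonunits \<Longrightarrow> monom P a n \<in> residually_zero"
  by (simp add: residually_zero_def)

text \<open>The reduction of \<open>p\<close> modulo the maximal ideal has degree \<open>r\<close>.\<close>

definition top_unit :: "(nat \<Rightarrow> 'a) \<Rightarrow> nat \<Rightarrow> bool" where
  "top_unit p r \<longleftrightarrow> coeff P p r \<in> Units R \<and> (\<forall>n>r. coeff P p n \<in> nonunits)"

lemma exists_top_unit:
  assumes "p \<in> carrier P" "p \<notin> residually_zero"
  shows "\<exists>r. top_unit p r"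
proof -
  let ?Q = "\<lambda>n. coeff P p n \<in> Units R"
  obtain k where k: "?Q k" using assms by (auto simp: residually_zero_def nonunits_def)
  have bound: "n \<le> deg R p" if "?Q n" for n
  proof (rule ccontr)
    assume "\<not> n \<le> deg R p"
    then have "coeff P p n = \<zero>" using assms(1) by (intro deg_aboveD) auto
    then show False using that unit_not_nonunit zero_nonunit by metis
  qed
  define r where "r = (GREATEST n. ?Q n)"
  have "?Q r" unfolding r_def using k bound by (rule GreatestI_nat)
  moreover have "coeff P p n \<in> nonunits" if "n > r" for n
  proof (rule ccontr)
    assume "coeff P p n \<notin> nonunits"
    then have "?Q n" using assms(1) by (simp add: nonunits_def)
    then have "n \<le> r" unfolding r_def using bound by (rule Greatest_le_nat)
    then show False using that by simp
  qed
  ultimately show ?thesis unfolding top_unit_def by blast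
qed

lemma top_unit_mult:
  assumes "p \<in> carrier P" "q \<in> carrier P" "top_unit p r" "top_unit q s"
  shows "coeff P (p \<otimes>\<^bsub>P\<^esub> q) (r + s) \<in> Units R"
proof -
  have "coeff P (p \<otimes>\<^bsub>P\<^esub> q) (r + s) = (\<Oplus>i\<in>insert r ({..r+s} - {r}). coeff P p i \<otimes> coeff P q (r + s - i))"
    using assms by (simp add: insert_absorb)
  also have "\<dots> = coeff P p r \<otimes> coeff P q s \<oplus>
      (\<Oplus>i\<in>{..r+s} - {r}. coeff P p i \<otimes> coeff P q (r + s - i))"
    by (subst R.finsum_insert) (use assms in auto)
  also have "\<dots> \<in> Units R"
  proof (rule unit_add_nonunit)
    show "coeff P p r \<otimes> coeff P q s \<in> Units R" using assms by (simp add: top_unit_def)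
    show "(\<Oplus>i\<in>{..r+s} - {r}. coeff P p i \<otimes> coeff P q (r + s - i)) \<in> nonunits"
    proof (rule nonunits_finsum)
      fix i assume i: "i \<in> {..r+s} - {r}"
      show "coeff P p i \<otimes> coeff P q (r + s - i) \<in> nonunits"
      proof (cases "i < r")
        case True
        then have "coeff P q (r + s - i) \<in> nonunits" using assms by (simp add: top_unit_def)
        then show ?thesis using assms by (simp add: nonunits_mult_left)
      next
        case False
        then have "coeff P p i \<in> nonunits" using i assms by (simp add: top_unit_def)
        then show ?thesis using assms by (simp add: nonunits_mult)
      qed
    qed simp
  qed
  finally show ?thesis .
qed

text \<open>Gauss's lemma over a local ring.\<close>

lemma residually_zero_prime:
  assumes "p \<in> carrier P" "q \<in> carrier P" "p \<otimes>\<^bsub>P\<^esub> q \<in> residually_zero"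
  shows "p \<in> residually_zero \<or> q \<in> residually_zero"
proof (rule ccontr)
  assume "\<not> ?thesis"
  then obtain r s where "top_unit p r" "top_unit q s" using exists_top_unit assms by blast
  then have "coeff P (p \<otimes>\<^bsub>P\<^esub> q) (r + s) \<in> Units R" using top_unit_mult assms by blast
  then show False using assms(3) unit_not_nonunit by (auto simp: residually_zero_def)
qed

lemma coeff_const_mult:
  assumes "c \<in> carrier R" "p \<in> carrier P"
  shows "coeff P (monom P c 0 \<otimes>\<^bsub>P\<^esub> p) n = c \<otimes> coeff P p n"
  using assms by (simp add: monom_mult_is_smult)

text \<open>Elimination is applied to the polynomials \<open>w i\<close> together with the shifts \<open>g, x g, x^2 g, \<dots>\<close>.  There are
  \<open>L\<close> shifts and \<open>d + 1\<close> polynomials \<open>w i\<close>, all of degree less than \<open>d + L\<close>, so a relation with a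
  unit coefficient exists.  If the coefficients of all \<open>w i\<close> were nonunits, then the
  multiple of \<open>g\<close> in the relation would vanish modulo the maximal ideal, and by Gauss's lemma so
  would its cofactor, leaving no unit coefficient at all.\<close>

lemma exists_relation_mod:
  assumes g: "g \<in> carrier P" "g \<notin> residually_zero" "deg R g \<le> d"
    and w: "\<And>i. i \<le> d \<Longrightarrow> w i \<in> carrier P"
  shows "\<exists>c. (\<forall>i\<le>d. c i \<in> carrier R) \<and> (\<exists>i\<le>d. c i \<in> Units R) \<and>
           (\<exists>q\<in>carrier P. (\<Oplus>\<^bsub>P\<^esub>i\<in>{..d}. monom P (c i) 0 \<otimes>\<^bsub>P\<^esub> w i) = g \<otimes>\<^bsub>P\<^esub> q)"
proof -
  define L where "L = Suc (Max ((\<lambda>i. deg R (w i)) ` {..d}))"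
  have degw: "deg R (w i) < d + L" if "i \<le> d" for i
  proof -
    have "deg R (w i) \<le> Max ((\<lambda>i. deg R (w i)) ` {..d})" using that by (intro Max_ge) auto
    then show ?thesis unfolding L_def by linarith
  qed
  define W where "W i = (if i \<le> d then w i else monom P \<one> (i - Suc d) \<otimes>\<^bsub>P\<^esub> g)" for i
  let ?I = "{..d + L}"
  have Wc: "W i \<in> carrier P" for i using w g by (simp add: W_def)
  have degW: "coeff P (W i) k = \<zero>" if i: "i \<in> ?I" and k: "\<not> k < d + L" for i k
  proof (cases "i \<le> d")
    case True
    then show ?thesis using degw[OF True] k w by (auto simp: W_def intro!: deg_aboveD)
  next
    case False
    then have "deg R (W i) \<le> (i - Suc d) + deg R g"
      unfolding W_def using g deg_monom_le[of \<one> "i - Suc d"]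
      by (auto intro!: order.trans[OF deg_mult_ring])
    also have "\<dots> < k" using i k g(3) False by auto
    finally show ?thesis using Wc by (intro deg_aboveD)
  qed
  have "\<exists>c. (\<forall>i\<in>?I. c i \<in> carrier R) \<and> (\<exists>i\<in>?I. c i \<in> Units R) \<and>
      (\<forall>k<d + L. (\<Oplus>i\<in>?I. c i \<otimes> coeff P (W i) k) = \<zero>)"
    by (rule exists_unimodular_relation) (use Wc in auto)
  then obtain c where c: "\<And>i. i \<in> ?I \<Longrightarrow> c i \<in> carrier R" and unit: "\<exists>i\<in>?I. c i \<in> Units R"
    and rel: "\<And>k. k < d + L \<Longrightarrow> (\<Oplus>i\<in>?I. c i \<otimes> coeff P (W i) k) = \<zero>" by blast
  let ?J = "{d<..d + L}"
  define S where "S = (\<Oplus>\<^bsub>P\<^esub>i\<in>{..d}. monom P (c i) 0 \<otimes>\<^bsub>P\<^esub> w i)"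
  define u where "u = (\<Oplus>\<^bsub>P\<^esub>i\<in>?J. monom P (c i) (i - Suc d))"
  have Sc: "S \<in> carrier P" unfolding S_def using c w by (intro P.finsum_closed) auto
  have uc: "u \<in> carrier P" unfolding u_def using c by (intro P.finsum_closed) auto
  have "(\<Oplus>\<^bsub>P\<^esub>i\<in>?I. monom P (c i) 0 \<otimes>\<^bsub>P\<^esub> W i) = \<zero>\<^bsub>P\<^esub>"
  proof (rule up_eqI)
    fix k
    have "coeff P (\<Oplus>\<^bsub>P\<^esub>i\<in>?I. monom P (c i) 0 \<otimes>\<^bsub>P\<^esub> W i) k = (\<Oplus>i\<in>?I. c i \<otimes> coeff P (W i) k)"
      by (subst coeff_finsum) (use c Wc in \<open>auto simp: coeff_const_mult simp del: coeff_mult intro!: R.finsum_cong'\<close>)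
    also have "\<dots> = \<zero>"
      by (cases "k < d + L") (use rel degW c in \<open>auto intro!: R.add.finprod_one_eqI\<close>)
    finally show "coeff P (\<Oplus>\<^bsub>P\<^esub>i\<in>?I. monom P (c i) 0 \<otimes>\<^bsub>P\<^esub> W i) k = coeff P \<zero>\<^bsub>P\<^esub> k" by simp
  qed (use c Wc in \<open>auto intro!: P.finsum_closed\<close>)
  also have "?I = {..d} \<union> ?J" by auto
  also have "(\<Oplus>\<^bsub>P\<^esub>i\<in>{..d} \<union> ?J. monom P (c i) 0 \<otimes>\<^bsub>P\<^esub> W i) =
      (\<Oplus>\<^bsub>P\<^esub>i\<in>{..d}. monom P (c i) 0 \<otimes>\<^bsub>P\<^esub> W i) \<oplus>\<^bsub>P\<^esub> (\<Oplus>\<^bsub>P\<^esub>i\<in>?J. monom P (c i) 0 \<otimes>\<^bsub>P\<^esub> W i)"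
    by (rule P.finsum_Un_disjoint) (use c Wc in auto)
  also have "(\<Oplus>\<^bsub>P\<^esub>i\<in>{..d}. monom P (c i) 0 \<otimes>\<^bsub>P\<^esub> W i) = S"
    unfolding S_def by (rule P.finsum_cong') (use c w in \<open>auto simp: W_def\<close>)
  also have "(\<Oplus>\<^bsub>P\<^esub>i\<in>?J. monom P (c i) 0 \<otimes>\<^bsub>P\<^esub> W i) = (\<Oplus>\<^bsub>P\<^esub>i\<in>?J. monom P (c i) (i - Suc d) \<otimes>\<^bsub>P\<^esub> g)"
  proof (rule P.finsum_cong')
    fix i assume i: "i \<in> ?J"
    then have ci: "c i \<in> carrier R" using c by auto
    then have "monom P (c i) (i - Suc d) = monom P (c i) 0 \<otimes>\<^bsub>P\<^esub> monom P \<one> (i - Suc d)"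
      using monom_mult[of "c i" \<one> 0 "i - Suc d"] by simp
    then show "monom P (c i) 0 \<otimes>\<^bsub>P\<^esub> W i = monom P (c i) (i - Suc d) \<otimes>\<^bsub>P\<^esub> g"
      using i ci g by (auto simp: W_def P.m_assoc)
  qed (use c g in auto)
  also have "\<dots> = u \<otimes>\<^bsub>P\<^esub> g"
    unfolding u_def by (rule P.finsum_ldistr[symmetric]) (use c g in auto)
  finally have Su: "S \<oplus>\<^bsub>P\<^esub> u \<otimes>\<^bsub>P\<^esub> g = \<zero>\<^bsub>P\<^esub>" .
  then have S: "S = g \<otimes>\<^bsub>P\<^esub> (\<ominus>\<^bsub>P\<^esub> u)"
    using Sc uc g by (metis P.minus_equality P.a_comm P.m_comm P.r_minus P.m_closed P.a_inv_closed)
  have "\<exists>i\<le>d. c i \<in> Units R"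
  proof (rule ccontr)
    assume no: "\<not> ?thesis"
    then have "S \<in> residually_zero" unfolding S_def
      by (intro residually_zero_finsum residually_zero_mult residually_zero_const)
         (use c w in \<open>auto simp: nonunits_def\<close>)
    then have "g \<otimes>\<^bsub>P\<^esub> (\<ominus>\<^bsub>P\<^esub> u) \<in> residually_zero" using S by simp
    then have "\<ominus>\<^bsub>P\<^esub> u \<in> residually_zero" using residually_zero_prime g uc by blast
    then have un: "u \<in> residually_zero" using residually_zero_minus[of "\<ominus>\<^bsub>P\<^esub> u"] uc by simp
    obtain j where j: "j \<in> ?J" "c j \<in> Units R" using unit no by (auto simp: not_le)
    have "coeff P u (j - Suc d) = (\<Oplus>i\<in>?J. coeff P (monom P (c i) (i - Suc d)) (j - Suc d))"
      unfolding u_def using c by (intro coeff_finsum) auto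
    also have "\<dots> = (\<Oplus>i\<in>?J. if j = i then c i else \<zero>)"
    proof (rule R.finsum_cong')
      fix i assume i: "i \<in> ?J"
      then have "c i \<in> carrier R" "i - Suc d = j - Suc d \<longleftrightarrow> j = i" using c j by auto
      then show "coeff P (monom P (c i) (i - Suc d)) (j - Suc d) = (if j = i then c i else \<zero>)"
        by simp
    qed (use c in auto)
    also have "\<dots> = c j"
      using c by (intro R.add.finprod_singleton j) auto
    finally have "c j \<in> nonunits" using un by (metis (lifting) mem_Collect_eq residually_zero_def)
    then show False using j(2) unit_not_nonunit by blast
  qed
  moreover have "\<ominus>\<^bsub>P\<^esub> u \<in> carrier P" using uc by simp
  moreover have "\<forall>i\<le>d. c i \<in> carrier R" using c by simp
  ultimately show ?thesis using S unfolding S_def by blast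
qed

end

section \<open>Comaximal combinations\<close>

context valuation_UP
begin

text \<open>Some \<open>a\<close> in the maximal ideal divides all coefficients of \<open>f\<close> but the constant one, so \<open>f\<close> is a
  unit modulo each power of \<open>a\<close>, and so is \<open>F = f - T h\<close> when \<open>T\<close> is a positive power of \<open>a\<close>.  Hence
  a power of \<open>a\<close> in the ideal \<open>(F, g)\<close>, where \<open>b + w f = a g\<close>, is enough to obtain \<open>1\<close> in \<open>(F, a g)\<close>.
  Such a power exists for suitable \<open>T\<close>: modulo \<open>(F, g)\<close> a relation between the \<open>f^i h^(d-i)\<close>
  becomes the vanishing of a constant that divides a power of \<open>a\<close>.\<close>

lemma stable_range:
  assumes f: "f \<in> carrier P" "coeff P f 0 \<in> Units R" "\<And>n. n > 0 \<Longrightarrow> coeff P f n \<in> nonunits"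
    and b: "b \<in> residually_zero" and h: "h \<in> carrier P"
    and uni: "\<alpha> \<in> carrier P" "\<beta> \<in> carrier P" "\<gamma> \<in> carrier P"
      "\<alpha> \<otimes>\<^bsub>P\<^esub> f \<oplus>\<^bsub>P\<^esub> \<beta> \<otimes>\<^bsub>P\<^esub> b \<oplus>\<^bsub>P\<^esub> \<gamma> \<otimes>\<^bsub>P\<^esub> h = \<one>\<^bsub>P\<^esub>"
  shows "\<exists>t\<in>carrier P. \<exists>w\<in>carrier P.
    \<one>\<^bsub>P\<^esub> \<in> P.ideal2 (f \<oplus>\<^bsub>P\<^esub> t \<otimes>\<^bsub>P\<^esub> h) (b \<oplus>\<^bsub>P\<^esub> w \<otimes>\<^bsub>P\<^esub> f)"
proof -
  let ?C = "\<lambda>a. monom P a 0"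
  interpret C: ring_hom_cring R P ?C
    by unfold_locales (rule const_ring_hom)
  have bc: "b \<in> carrier P" using b by (rule residually_zero_closed)
  define u where "u = coeff P f 0"
  define v where "v = inv u"
  have u: "u \<in> carrier R" "u \<in> Units R" using f by (simp_all add: u_def)
  have v: "v \<in> carrier R" "u \<otimes> v = \<one>" using u by (simp_all add: v_def)
  obtain a where a: "a \<in> nonunits" and adiv: "\<And>n. n > 0 \<Longrightarrow> a divides coeff P f n"
  proof -
    \<comment> \<open>The value \<open>0\<close> at \<open>0\<close> keeps the index set nonempty and supplies \<open>a = 0\<close> for constant \<open>f\<close>.\<close>
    define e where "e n = (if n = 0 then \<zero> else coeff P f n)" for n
    have e: "e n \<in> nonunits" for n using f(3) by (simp add: e_def)
    obtain k where k: "\<forall>i\<in>{..deg R f}. e k divides e i"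
      using exists_common_divisor[of "{..deg R f}" e] e nonunits_closed by auto
    have "e k divides coeff P f n" if n: "n > 0" for n
    proof (cases "n \<le> deg R f")
      case True
      then have "e k divides e n" using k by simp
      moreover have "e n = coeff P f n" using n by (simp add: e_def)
      ultimately show ?thesis by simp
    next
      case False
      then have "coeff P f n = \<zero>" using f(1) by (intro deg_aboveD) auto
      then have "coeff P f n = e k \<otimes> \<zero>" using nonunits_closed[OF e] by simp
      then show ?thesis unfolding factor_def by blast
    qed
    then show ?thesis using that e by blast
  qed
  have ac: "a \<in> carrier R" using a by (rule nonunits_closed)
  obtain z where z: "z \<in> carrier P" and fz: "f = ?C u \<oplus>\<^bsub>P\<^esub> ?C a \<otimes>\<^bsub>P\<^esub> z"
  proof -
    have "\<exists>q\<in>carrier R. coeff P f n = a \<otimes> q" if "n > 0" for n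
      using adiv[OF that] by (auto simp: factor_def)
    then obtain q where q: "\<And>n. n > 0 \<Longrightarrow> q n \<in> carrier R" "\<And>n. n > 0 \<Longrightarrow> coeff P f n = a \<otimes> q n"
      by metis
    define z where "z n = (if n = 0 \<or> deg R f < n then \<zero> else q n)" for n
    have "z \<in> up R"
      by (rule mem_upI) (auto simp: z_def q intro!: exI[of _ "deg R f"])
    then have zc: "z \<in> carrier P" and zn: "coeff P z n = z n" for n by (simp_all add: P_def UP_def)
    have "f = ?C u \<oplus>\<^bsub>P\<^esub> ?C a \<otimes>\<^bsub>P\<^esub> z"
    proof (rule up_eqI)
      fix n
      have "coeff P (?C u \<oplus>\<^bsub>P\<^esub> ?C a \<otimes>\<^bsub>P\<^esub> z) n = coeff P (?C u) n \<oplus> a \<otimes> z n"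
        using zc u ac by (simp add: coeff_const_mult zn del: coeff_mult)
      also have "\<dots> = coeff P f n"
        using u ac f(1) q deg_aboveD[of f n] by (auto simp: z_def u_def)
      finally show "coeff P f n = coeff P (?C u \<oplus>\<^bsub>P\<^esub> ?C a \<otimes>\<^bsub>P\<^esub> z) n" ..
    qed (use f zc u ac in auto)
    then show ?thesis using that zc by blast
  qed
  define U where "U = ?C u"
  define V where "V = ?C v"
  define A where "A = ?C a"
  have cr: "U \<in> carrier P" "V \<in> carrier P" "A \<in> carrier P"
    using u v ac by (simp_all add: U_def V_def A_def)
  have UV: "U \<otimes>\<^bsub>P\<^esub> V = \<one>\<^bsub>P\<^esub>" unfolding U_def V_def
    using C.hom_mult[of u v] u v by (metis C.hom_one)
  have Az: "A \<in> residually_zero" unfolding A_def using a by (rule residually_zero_const)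
  \<comment> \<open>This \<open>w\<close> makes the second generator equal to \<open>a g\<close> with \<open>g\<close> congruent to \<open>1\<close> modulo the maximal
    ideal; the factor \<open>a\<close> is harmless since \<open>f\<close> is a unit modulo \<open>a\<close>.\<close>
  define w where "w = V \<otimes>\<^bsub>P\<^esub> (A \<ominus>\<^bsub>P\<^esub> b)"
  define g' where "g' = V \<otimes>\<^bsub>P\<^esub> (A \<ominus>\<^bsub>P\<^esub> b) \<otimes>\<^bsub>P\<^esub> z"
  define g where "g = \<one>\<^bsub>P\<^esub> \<oplus>\<^bsub>P\<^esub> g'"
  have w: "w \<in> carrier P" using cr bc by (simp add: w_def)
  have g'0: "g' \<in> residually_zero" unfolding g'_def P.minus_eq
    using Az b cr z by (intro residually_zero_mult residually_zero_mult_left residually_zero_add residually_zero_minus)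
  then have g'c: "g' \<in> carrier P" by (rule residually_zero_closed)
  have g: "g \<in> carrier P" using g'c by (simp add: g_def)
  have "coeff P g 0 = \<one> \<oplus> coeff P g' 0" using g'c by (simp add: g_def)
  also have "\<dots> \<in> Units R" using g'0 by (intro unit_add_nonunit) (auto simp: residually_zero_def)
  finally have gn: "g \<notin> residually_zero" using unit_not_nonunit by (auto simp: residually_zero_def)
  have bw: "b \<oplus>\<^bsub>P\<^esub> w \<otimes>\<^bsub>P\<^esub> f = A \<otimes>\<^bsub>P\<^esub> g"
  proof -
    have "b \<oplus>\<^bsub>P\<^esub> w \<otimes>\<^bsub>P\<^esub> f = b \<oplus>\<^bsub>P\<^esub> (U \<otimes>\<^bsub>P\<^esub> V) \<otimes>\<^bsub>P\<^esub> (A \<ominus>\<^bsub>P\<^esub> b) \<oplus>\<^bsub>P\<^esub> A \<otimes>\<^bsub>P\<^esub> g'"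
      unfolding fz U_def[symmetric] A_def[symmetric] w_def g'_def using cr z bc by algebra
    also have "\<dots> = A \<otimes>\<^bsub>P\<^esub> g" unfolding UV g_def using cr bc g'c by algebra
    finally show ?thesis .
  qed
  define d where "d = deg R g"
  define W where "W i = f [^]\<^bsub>P\<^esub> i \<otimes>\<^bsub>P\<^esub> h [^]\<^bsub>P\<^esub> (d - i)" for i :: nat
  have "W i \<in> carrier P" for i using f h by (simp add: W_def)
  then obtain c q where c: "\<And>i. i \<le> d \<Longrightarrow> c i \<in> carrier R" and "\<exists>i\<le>d. c i \<in> Units R"
    and q: "q \<in> carrier P" "(\<Oplus>\<^bsub>P\<^esub>i\<in>{..d}. ?C (c i) \<otimes>\<^bsub>P\<^esub> W i) = g \<otimes>\<^bsub>P\<^esub> q"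
    using exists_relation_mod[OF g gn, of d W] unfolding d_def by blast
  then obtain k where k: "k \<le> d" "c k \<in> Units R" by blast
  obtain M N where MN: "(\<Oplus>i\<in>{..d}. c i \<otimes> (a [^] Suc M) [^] i) divides (a [^] (N::nat))"
    using exists_power_value_divides_power[of d c, OF c k a] by blast
  define s where "s = (\<Oplus>i\<in>{..d}. c i \<otimes> (a [^] Suc M) [^] i)"
  have sc: "s \<in> carrier R" unfolding s_def using c ac by (intro R.finsum_closed) auto
  obtain r where r: "r \<in> carrier R" "a [^] N = s \<otimes> r" using MN by (auto simp: s_def factor_def)
  define T where "T = A [^]\<^bsub>P\<^esub> Suc M"
  have T: "T \<in> carrier P" using cr by (simp add: T_def)
  have T': "T = ?C (a [^] Suc M)" unfolding T_def A_def using ac C.hom_pow by metis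
  define F where "F = f \<ominus>\<^bsub>P\<^esub> T \<otimes>\<^bsub>P\<^esub> h"
  have F: "F \<in> carrier P" using f T h by (simp add: F_def)
  have idI: "ideal (P.ideal2 F g) P" using F g by (rule P.ideal_ideal2)
  have uni': "(\<alpha> \<ominus>\<^bsub>P\<^esub> \<beta> \<otimes>\<^bsub>P\<^esub> w) \<otimes>\<^bsub>P\<^esub> f \<oplus>\<^bsub>P\<^esub> (\<beta> \<otimes>\<^bsub>P\<^esub> A) \<otimes>\<^bsub>P\<^esub> g \<oplus>\<^bsub>P\<^esub> \<gamma> \<otimes>\<^bsub>P\<^esub> h = \<one>\<^bsub>P\<^esub>"
  proof -
    have "(\<alpha> \<ominus>\<^bsub>P\<^esub> \<beta> \<otimes>\<^bsub>P\<^esub> w) \<otimes>\<^bsub>P\<^esub> f \<oplus>\<^bsub>P\<^esub> (\<beta> \<otimes>\<^bsub>P\<^esub> A) \<otimes>\<^bsub>P\<^esub> g \<oplus>\<^bsub>P\<^esub> \<gamma> \<otimes>\<^bsub>P\<^esub> h =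
      (\<alpha> \<ominus>\<^bsub>P\<^esub> \<beta> \<otimes>\<^bsub>P\<^esub> w) \<otimes>\<^bsub>P\<^esub> f \<oplus>\<^bsub>P\<^esub> \<beta> \<otimes>\<^bsub>P\<^esub> (A \<otimes>\<^bsub>P\<^esub> g) \<oplus>\<^bsub>P\<^esub> \<gamma> \<otimes>\<^bsub>P\<^esub> h"
      using uni cr g by (simp add: P.m_assoc)
    also have "\<dots> = \<alpha> \<otimes>\<^bsub>P\<^esub> f \<oplus>\<^bsub>P\<^esub> \<beta> \<otimes>\<^bsub>P\<^esub> b \<oplus>\<^bsub>P\<^esub> \<gamma> \<otimes>\<^bsub>P\<^esub> h"
      unfolding bw[symmetric] using uni(1-3) f(1) h w bc by algebra
    finally show ?thesis using uni(4) by simp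
  qed
  define \<delta> where "\<delta> = \<alpha> \<ominus>\<^bsub>P\<^esub> \<beta> \<otimes>\<^bsub>P\<^esub> w"
  define \<epsilon> where "\<epsilon> = \<beta> \<otimes>\<^bsub>P\<^esub> A"
  have de: "\<delta> \<in> carrier P" "\<epsilon> \<in> carrier P" using uni w cr by (simp_all add: \<delta>_def \<epsilon>_def)
  have "(\<Oplus>\<^bsub>P\<^esub>i\<in>{..d}. ?C (c i) \<otimes>\<^bsub>P\<^esub> T [^]\<^bsub>P\<^esub> i) \<in> P.ideal2 F g"
  proof (rule P.ideal_dehomogenize[OF idI f(1) h T, of "\<gamma> \<oplus>\<^bsub>P\<^esub> \<delta> \<otimes>\<^bsub>P\<^esub> T"])
    \<comment> \<open>The inverse of \<open>h\<close> comes from substituting \<open>f = T h\<close> in the unimodularity relation.\<close>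
    show "\<gamma> \<oplus>\<^bsub>P\<^esub> \<delta> \<otimes>\<^bsub>P\<^esub> T \<in> carrier P" using uni T de by simp
    show "?C (c i) \<in> carrier P" if "i \<le> d" for i using c that by simp
    show "f \<ominus>\<^bsub>P\<^esub> T \<otimes>\<^bsub>P\<^esub> h \<in> P.ideal2 F g"
      by (rule P.ideal2I[of "\<one>\<^bsub>P\<^esub>" "\<zero>\<^bsub>P\<^esub>"]) (use F g f T h in \<open>simp_all add: F_def\<close>)
    have "h \<otimes>\<^bsub>P\<^esub> (\<gamma> \<oplus>\<^bsub>P\<^esub> \<delta> \<otimes>\<^bsub>P\<^esub> T) \<ominus>\<^bsub>P\<^esub> (\<delta> \<otimes>\<^bsub>P\<^esub> f \<oplus>\<^bsub>P\<^esub> \<epsilon> \<otimes>\<^bsub>P\<^esub> g \<oplus>\<^bsub>P\<^esub> \<gamma> \<otimes>\<^bsub>P\<^esub> h) =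
        (\<ominus>\<^bsub>P\<^esub> \<delta>) \<otimes>\<^bsub>P\<^esub> F \<oplus>\<^bsub>P\<^esub> (\<ominus>\<^bsub>P\<^esub> \<epsilon>) \<otimes>\<^bsub>P\<^esub> g"
      unfolding F_def using uni(3) T de h f(1) g by algebra
    then show "h \<otimes>\<^bsub>P\<^esub> (\<gamma> \<oplus>\<^bsub>P\<^esub> \<delta> \<otimes>\<^bsub>P\<^esub> T) \<ominus>\<^bsub>P\<^esub> \<one>\<^bsub>P\<^esub> \<in> P.ideal2 F g"
      using uni' de unfolding \<delta>_def[symmetric] \<epsilon>_def[symmetric]
      by (intro P.ideal2I[of "\<ominus>\<^bsub>P\<^esub> \<delta>" "\<ominus>\<^bsub>P\<^esub> \<epsilon>"]) simp_all
    show "(\<Oplus>\<^bsub>P\<^esub>i\<in>{..d}. ?C (c i) \<otimes>\<^bsub>P\<^esub> (f [^]\<^bsub>P\<^esub> i \<otimes>\<^bsub>P\<^esub> h [^]\<^bsub>P\<^esub> (d - i))) \<in> P.ideal2 F g"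
      using q F g unfolding W_def
      by (intro P.ideal2I[of "\<zero>\<^bsub>P\<^esub>" q]) (simp_all add: P.m_comm)
  qed
  also have "(\<Oplus>\<^bsub>P\<^esub>i\<in>{..d}. ?C (c i) \<otimes>\<^bsub>P\<^esub> T [^]\<^bsub>P\<^esub> i) = ?C s"
  proof -
    have "?C s = (\<Oplus>\<^bsub>P\<^esub>i\<in>{..d}. ?C (c i \<otimes> (a [^] Suc M) [^] i))"
      unfolding s_def using c ac by (subst C.hom_finsum) (auto simp: comp_def)
    also have "\<dots> = (\<Oplus>\<^bsub>P\<^esub>i\<in>{..d}. ?C (c i) \<otimes>\<^bsub>P\<^esub> T [^]\<^bsub>P\<^esub> i)"
    proof (rule P.finsum_cong')
      fix i assume "i \<in> {..d}"
      then show "?C (c i \<otimes> (a [^] Suc M) [^] i) = ?C (c i) \<otimes>\<^bsub>P\<^esub> T [^]\<^bsub>P\<^esub> i"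
        using c ac unfolding T' by (metis C.hom_mult C.hom_pow R.nat_pow_closed atMost_iff)
    qed (use c T in auto)
    finally show ?thesis ..
  qed
  finally have "?C s \<in> P.ideal2 F g" .
  then obtain x y where xy: "x \<in> carrier P" "y \<in> carrier P" "?C s = x \<otimes>\<^bsub>P\<^esub> F \<oplus>\<^bsub>P\<^esub> y \<otimes>\<^bsub>P\<^esub> g"
    by (rule P.ideal2E)
  define \<rho> where "\<rho> = ?C r"
  have \<rho>: "\<rho> \<in> carrier P" using r by (simp add: \<rho>_def)
  have "A [^]\<^bsub>P\<^esub> N = ?C (a [^] N)" unfolding A_def using ac C.hom_pow by metis
  also have "\<dots> = (x \<otimes>\<^bsub>P\<^esub> F \<oplus>\<^bsub>P\<^esub> y \<otimes>\<^bsub>P\<^esub> g) \<otimes>\<^bsub>P\<^esub> \<rho>"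
    unfolding xy(3)[symmetric] r(2) \<rho>_def using sc r(1) by (rule C.hom_mult)
  finally have "A [^]\<^bsub>P\<^esub> Suc N = (x \<otimes>\<^bsub>P\<^esub> F \<oplus>\<^bsub>P\<^esub> y \<otimes>\<^bsub>P\<^esub> g) \<otimes>\<^bsub>P\<^esub> \<rho> \<otimes>\<^bsub>P\<^esub> A" by simp
  also have "\<dots> = (x \<otimes>\<^bsub>P\<^esub> \<rho> \<otimes>\<^bsub>P\<^esub> A) \<otimes>\<^bsub>P\<^esub> F \<oplus>\<^bsub>P\<^esub> (y \<otimes>\<^bsub>P\<^esub> \<rho>) \<otimes>\<^bsub>P\<^esub> (A \<otimes>\<^bsub>P\<^esub> g)"
    using xy(1,2) F g \<rho> cr by algebra
  finally have pow: "A [^]\<^bsub>P\<^esub> Suc N \<in> P.ideal2 F (A \<otimes>\<^bsub>P\<^esub> g)"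
    by (intro P.ideal2I) (use xy \<rho> cr in auto)
  have "\<one>\<^bsub>P\<^esub> \<in> P.ideal2 F (A \<otimes>\<^bsub>P\<^esub> g)"
  proof (rule P.ideal_one_of_power[OF _ cr(3,1,2) _ UV _ pow])
    show "ideal (P.ideal2 F (A \<otimes>\<^bsub>P\<^esub> g)) P" using F g cr by (intro P.ideal_ideal2) auto
    define B where "B = A [^]\<^bsub>P\<^esub> M"
    have B: "B \<in> carrier P" using cr by (simp add: B_def)
    show "z \<ominus>\<^bsub>P\<^esub> A [^]\<^bsub>P\<^esub> M \<otimes>\<^bsub>P\<^esub> h \<in> carrier P" using z cr h by simp
    have "F = U \<oplus>\<^bsub>P\<^esub> A \<otimes>\<^bsub>P\<^esub> (z \<ominus>\<^bsub>P\<^esub> B \<otimes>\<^bsub>P\<^esub> h)"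
      unfolding F_def fz T_def nat_pow_Suc U_def[symmetric] A_def[symmetric] B_def[symmetric]
      using z cr h B by algebra
    then show "U \<oplus>\<^bsub>P\<^esub> A \<otimes>\<^bsub>P\<^esub> (z \<ominus>\<^bsub>P\<^esub> A [^]\<^bsub>P\<^esub> M \<otimes>\<^bsub>P\<^esub> h) \<in> P.ideal2 F (A \<otimes>\<^bsub>P\<^esub> g)"
      unfolding B_def[symmetric]
      by (intro P.ideal2I[of "\<one>\<^bsub>P\<^esub>" "\<zero>\<^bsub>P\<^esub>"]) (use F g cr in simp_all)
  qed
  moreover have "F = f \<oplus>\<^bsub>P\<^esub> (\<ominus>\<^bsub>P\<^esub> T) \<otimes>\<^bsub>P\<^esub> h" unfolding F_def using f(1) T h by algebra
  moreover have "\<ominus>\<^bsub>P\<^esub> T \<in> carrier P" using T by simp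
  ultimately show ?thesis using w bw by metis
qed

end

section \<open>Unimodular rows over polynomial rings\<close>

context valuation_UP
begin

text \<open>Zero for polynomials that vanish modulo the maximal ideal, otherwise one more than the degree of
  the reduction.\<close>

definition residual_size :: "(nat \<Rightarrow> 'a) \<Rightarrow> nat" where
  "residual_size p = (LEAST d. \<forall>n\<ge>d. coeff P p n \<in> nonunits)"

lemma residual_size_le: "(\<And>n. n \<ge> d \<Longrightarrow> coeff P p n \<in> nonunits) \<Longrightarrow> residual_size p \<le> d"
  unfolding residual_size_def by (intro Least_le) blast

lemma residual_size_top_unit:
  assumes "top_unit p r"
  shows "residual_size p = Suc r"
  unfolding residual_size_def
proof (rule Least_equality)
  show "\<forall>n\<ge>Suc r. coeff P p n \<in> nonunits" using assms by (simp add: top_unit_def)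
  show "Suc r \<le> d" if "\<forall>n\<ge>d. coeff P p n \<in> nonunits" for d
    using that assms unit_not_nonunit by (metis not_less_eq_eq top_unit_def)
qed

text \<open>A step of division with remainder over the residue field, which cancels the leading term of the
  reduction of \<open>p'\<close>.\<close>

lemma exists_residual_reduction:
  assumes p: "p \<in> carrier P" "top_unit p r" and p': "p' \<in> carrier P" "top_unit p' s" and rs: "r \<le> s"
  shows "\<exists>q\<in>carrier P. residual_size (p' \<oplus>\<^bsub>P\<^esub> q \<otimes>\<^bsub>P\<^esub> p) < residual_size p'"
proof -
  define c where "c = \<ominus> (coeff P p' s \<otimes> inv (coeff P p r))"
  have u: "coeff P p r \<in> Units R" using p(2) by (simp add: top_unit_def)
  have cr: "coeff P p' s \<in> carrier R" "coeff P p r \<in> carrier R" "inv (coeff P p r) \<in> carrier R"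
    using p p' u by simp_all
  have c: "c \<in> carrier R" using cr by (simp add: c_def)
  define q where "q = monom P c (s - r)"
  have q: "q \<in> carrier P" using c by (simp add: q_def)
  have "coeff P (p' \<oplus>\<^bsub>P\<^esub> q \<otimes>\<^bsub>P\<^esub> p) n \<in> nonunits" if n: "n \<ge> s" for n
  proof -
    obtain k where k: "n = s + k" using n le_Suc_ex by blast
    then have "n = (r + k) + (s - r)" using rs by simp
    then have "coeff P (q \<otimes>\<^bsub>P\<^esub> p) n = c \<otimes> coeff P p (r + k)"
      unfolding q_def using coeff_monom_mult[OF c p(1), of "s - r" "r + k"] by simp
    then have e: "coeff P (p' \<oplus>\<^bsub>P\<^esub> q \<otimes>\<^bsub>P\<^esub> p) n = coeff P p' n \<oplus> c \<otimes> coeff P p (r + k)"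
      using p p' q by (simp del: coeff_mult)
    show ?thesis
    proof (cases "k = 0")
      case True
      have "c \<otimes> coeff P p r = \<ominus> (coeff P p' s \<otimes> (inv (coeff P p r) \<otimes> coeff P p r))"
        unfolding c_def using cr by algebra
      also have "\<dots> = \<ominus> coeff P p' s" using u cr by simp
      finally show ?thesis using e k True cr by (simp add: R.r_neg)
    next
      case False
      then have "coeff P p' n \<in> nonunits" "coeff P p (r + k) \<in> nonunits"
        using p(2) p'(2) k by (simp_all add: top_unit_def)
      then show ?thesis unfolding e using c by (intro nonunits_add nonunits_mult_left)
    qed
  qed
  then have "residual_size (p' \<oplus>\<^bsub>P\<^esub> q \<otimes>\<^bsub>P\<^esub> p) \<le> s" by (rule residual_size_le)
  then show ?thesis using residual_size_top_unit[OF p'(2)] q by (intro bexI[of _ q]) auto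
qed

text \<open>Over the residue field, a divisor of \<open>1\<close> is constant.\<close>

lemma residually_unit_constant:
  assumes p: "p \<in> carrier P" and q: "q \<in> carrier P" and e: "e \<in> residually_zero"
    and one: "p \<otimes>\<^bsub>P\<^esub> q \<oplus>\<^bsub>P\<^esub> e = \<one>\<^bsub>P\<^esub>"
  shows "top_unit p 0"
proof -
  have ec: "e \<in> carrier P" using e by (rule residually_zero_closed)
  have en: "coeff P e n \<in> nonunits" for n using e by (simp add: residually_zero_def)
  have "p \<otimes>\<^bsub>P\<^esub> q \<notin> residually_zero"
  proof
    assume "p \<otimes>\<^bsub>P\<^esub> q \<in> residually_zero"
    then have "\<one>\<^bsub>P\<^esub> \<in> residually_zero" using residually_zero_add[OF _ e] one by metis
    then have "coeff P \<one>\<^bsub>P\<^esub> 0 \<in> nonunits" by (simp only: residually_zero_def mem_Collect_eq)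
    then show False using unit_not_nonunit by simp
  qed
  then obtain r s where r: "top_unit p r" and s: "top_unit q s"
    using residually_zero_mult[OF _ q] residually_zero_mult_left[OF _ p] exists_top_unit p q by meson
  have "r + s = 0"
  proof (rule ccontr)
    assume rs: "r + s \<noteq> 0"
    have "coeff P (p \<otimes>\<^bsub>P\<^esub> q) (r + s) \<oplus> coeff P e (r + s) = coeff P \<one>\<^bsub>P\<^esub> (r + s)"
      unfolding one[symmetric] using p q ec by (simp del: coeff_mult)
    moreover have "coeff P \<one>\<^bsub>P\<^esub> (r + s) = \<zero>" using rs by (simp only: coeff_one if_False)
    ultimately have "\<zero> \<in> Units R"
      using unit_add_nonunit[OF top_unit_mult[OF p q r s] en, of "r + s"] by simp
    then show False using unit_not_nonunit zero_nonunit by blast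
  qed
  then show ?thesis using r by simp
qed

text \<open>The remaining entries enter the row only through their combination \<open>h\<close> in the unimodularity
  relation, and adding \<open>t h\<close> to entry \<open>i\<close> is an elementary operation.  This leaves two comaximal
  entries and, as \<open>n\<close> is at least three, a third one.\<close>

lemma has_free_kernel_of_residual_unit_vector:
  assumes uni: "unimodular_row P n f" and n: "n \<ge> 3" and i: "i < n"
    and zero: "\<And>j. j < n \<Longrightarrow> j \<noteq> i \<Longrightarrow> f j \<in> residually_zero"
  shows "has_free_kernel P n f"
proof -
  obtain g where f: "f \<in> {..<n} \<rightarrow> carrier P" and g: "g \<in> carrier (free_mod P n)"
    and fg: "row_pairing P n f g = \<one>\<^bsub>P\<^esub>" using uni by (auto simp: unimodular_row_def)
  have fc: "f j \<in> carrier P" if "j < n" for j using f that by auto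
  have gc: "g j \<in> carrier P" if "j < n" for j using g that by (rule free_mod_memD)
  have "\<exists>j<n. j \<noteq> i"
    using n by (intro exI[of _ "if i = 0 then 1 else 0"]) auto
  then obtain j where j: "j < n" "j \<noteq> i" by blast
  have "\<exists>l<n. l \<noteq> i \<and> l \<noteq> j"
  proof -
    have "card {i, j} < card {..<n}" using n card_insert_le_m1[of 2 "{j}" i] by simp
    then have "\<not> {..<n} \<subseteq> {i, j}" using card_mono[of "{i, j}" "{..<n}"] by auto
    then show ?thesis by auto
  qed
  then obtain l where l: "l < n" "l \<noteq> i" "l \<noteq> j" by blast
  let ?J = "{..<n} - {i} - {j}"
  define h where "h = (\<Oplus>\<^bsub>P\<^esub>k\<in>?J. g k \<otimes>\<^bsub>P\<^esub> f k)"
  have h: "h \<in> carrier P" unfolding h_def using fc gc by (intro P.finsum_closed) auto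
  have hz: "h \<in> residually_zero" unfolding h_def
    using zero gc by (intro residually_zero_finsum residually_zero_mult_left) auto
  have one: "g i \<otimes>\<^bsub>P\<^esub> f i \<oplus>\<^bsub>P\<^esub> g j \<otimes>\<^bsub>P\<^esub> f j \<oplus>\<^bsub>P\<^esub> h = \<one>\<^bsub>P\<^esub>"
  proof -
    have "row_pairing P n f g = f i \<otimes>\<^bsub>P\<^esub> g i \<oplus>\<^bsub>P\<^esub> (\<Oplus>\<^bsub>P\<^esub>k\<in>{..<n} - {i}. f k \<otimes>\<^bsub>P\<^esub> g k)"
      using gc by (intro P.row_pairing_split f i) auto
    also have "(\<Oplus>\<^bsub>P\<^esub>k\<in>{..<n} - {i}. f k \<otimes>\<^bsub>P\<^esub> g k) = (\<Oplus>\<^bsub>P\<^esub>k\<in>insert j ?J. g k \<otimes>\<^bsub>P\<^esub> f k)"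
      by (rule P.finsum_cong') (use j fc gc P.m_comm in auto)
    also have "\<dots> = g j \<otimes>\<^bsub>P\<^esub> f j \<oplus>\<^bsub>P\<^esub> h"
      unfolding h_def by (rule P.finsum_insert) (use j fc gc in auto)
    finally show ?thesis using fg fc gc i j h P.m_comm[of "f i" "g i"] by (simp add: P.a_assoc)
  qed
  have top: "top_unit (f i) 0"
  proof (rule residually_unit_constant)
    show "g j \<otimes>\<^bsub>P\<^esub> f j \<oplus>\<^bsub>P\<^esub> h \<in> residually_zero"
      using zero[OF j] gc j hz by (intro residually_zero_add residually_zero_mult_left)
    show "f i \<otimes>\<^bsub>P\<^esub> g i \<oplus>\<^bsub>P\<^esub> (g j \<otimes>\<^bsub>P\<^esub> f j \<oplus>\<^bsub>P\<^esub> h) = \<one>\<^bsub>P\<^esub>"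
      using one fc gc i j h P.m_comm[of "f i" "g i"] by (simp add: P.a_assoc)
  qed (use fc gc i in auto)
  have "\<exists>t\<in>carrier P. \<exists>w\<in>carrier P.
      \<one>\<^bsub>P\<^esub> \<in> P.ideal2 (f i \<oplus>\<^bsub>P\<^esub> t \<otimes>\<^bsub>P\<^esub> h) (f j \<oplus>\<^bsub>P\<^esub> w \<otimes>\<^bsub>P\<^esub> f i)"
  proof (rule stable_range)
    show "coeff P (f i) 0 \<in> Units R" "\<And>n. n > 0 \<Longrightarrow> coeff P (f i) n \<in> nonunits"
      using top by (simp_all add: top_unit_def)
    show "g i \<otimes>\<^bsub>P\<^esub> f i \<oplus>\<^bsub>P\<^esub> g j \<otimes>\<^bsub>P\<^esub> f j \<oplus>\<^bsub>P\<^esub> \<one>\<^bsub>P\<^esub> \<otimes>\<^bsub>P\<^esub> h = \<one>\<^bsub>P\<^esub>"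
      using one h by simp
  qed (use fc gc i j h zero in auto)
  then obtain t w where t: "t \<in> carrier P" and w: "w \<in> carrier P"
    and tw: "\<one>\<^bsub>P\<^esub> \<in> P.ideal2 (f i \<oplus>\<^bsub>P\<^esub> t \<otimes>\<^bsub>P\<^esub> h) (f j \<oplus>\<^bsub>P\<^esub> w \<otimes>\<^bsub>P\<^esub> f i)" by blast
  define f1 where "f1 = f(j := f j \<oplus>\<^bsub>P\<^esub> w \<otimes>\<^bsub>P\<^esub> f i)"
  have f1: "f1 \<in> {..<n} \<rightarrow> carrier P" using f fc w i j by (auto simp: f1_def)
  define c where "c k = (if k = j then \<zero>\<^bsub>P\<^esub> else t \<otimes>\<^bsub>P\<^esub> g k)" for k
  have c: "c \<in> {..<n} \<rightarrow> carrier P" using t gc by (auto simp: c_def)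
  define f2 where "f2 = shear_row P n i c f1"
  have f2: "f2 \<in> {..<n} \<rightarrow> carrier P" unfolding f2_def using f1 c i by (rule P.shear_row_closed)
  have "f2 i = f i \<oplus>\<^bsub>P\<^esub> t \<otimes>\<^bsub>P\<^esub> h"
  proof -
    have "(\<Oplus>\<^bsub>P\<^esub>k\<in>{..<n} - {i}. c k \<otimes>\<^bsub>P\<^esub> f1 k) = (\<Oplus>\<^bsub>P\<^esub>k\<in>?J. t \<otimes>\<^bsub>P\<^esub> (g k \<otimes>\<^bsub>P\<^esub> f k))"
      by (rule P.add.finprod_mono_neutral_cong_right)
         (use t fc gc w i in \<open>auto simp: c_def f1_def P.m_assoc\<close>)
    also have "\<dots> = t \<otimes>\<^bsub>P\<^esub> h"
      unfolding h_def by (rule P.finsum_rdistr[symmetric]) (use t fc gc in auto)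
    finally show ?thesis using j by (simp add: f2_def shear_row_def f1_def)
  qed
  moreover have "f2 j = f j \<oplus>\<^bsub>P\<^esub> w \<otimes>\<^bsub>P\<^esub> f i" using j by (simp add: f2_def shear_row_def f1_def)
  ultimately have "has_free_kernel P n f2"
    using P.has_free_kernel_of_unimodular_pair[OF f2 i j(1) j(2)[symmetric] l] tw by simp
  then have "has_free_kernel P n f1"
    unfolding f2_def by (rule P.has_free_kernel_of_shear[OF f1 c i])
  then show ?thesis
    using P.has_free_kernel_add_multiple[OF f w j(1) i j(2)] by (simp add: f1_def)
qed

text \<open>The Euclidean algorithm over the residue field: as long as two entries are nonzero modulo the
  maximal ideal, the one of higher residual degree can be reduced.\<close>

lemma unimodular_row_has_free_kernel:
  assumes "unimodular_row P n f"
  shows "has_free_kernel P n f"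
proof (cases "n \<le> 2")
  case True
  then show ?thesis using P.has_free_kernel_short assms by simp
next
  case False
  then have n: "n \<ge> 3" by simp
  show ?thesis using assms
  proof (induction "\<Sum>i<n. residual_size (f i)" arbitrary: f rule: less_induct)
    case less
    have fc: "f j \<in> carrier P" if "j < n" for j using less.prems that by (auto simp: unimodular_row_def)
    show ?case
    proof (cases "\<exists>i<n. \<forall>j<n. j \<noteq> i \<longrightarrow> f j \<in> residually_zero")
      case True
      then show ?thesis using has_free_kernel_of_residual_unit_vector[OF less.prems n] by blast
    next
      case False
      have other: "\<exists>j<n. j \<noteq> i \<and> f j \<notin> residually_zero" if "i < n" for i
      proof (rule ccontr)
        assume "\<not> ?thesis"
        then have "\<forall>j<n. j \<noteq> i \<longrightarrow> f j \<in> residually_zero" by blast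
        with that have "\<exists>i<n. \<forall>j<n. j \<noteq> i \<longrightarrow> f j \<in> residually_zero" by (intro exI[of _ i] conjI)
        with False show False by (rule notE)
      qed
      have "0 < n" using n by simp
      then obtain i where i: "i < n" "f i \<notin> residually_zero" using other[of 0] by auto
      obtain j where j: "j < n" "j \<noteq> i" "f j \<notin> residually_zero" using other[OF i(1)] by auto
      obtain r where r: "top_unit (f i) r" using exists_top_unit[OF fc[OF i(1)] i(2)] ..
      obtain s where s: "top_unit (f j) s" using exists_top_unit[OF fc[OF j(1)] j(3)] ..
      have "\<exists>k l q. k < n \<and> l < n \<and> k \<noteq> l \<and> q \<in> carrier P \<and>
          residual_size (f k \<oplus>\<^bsub>P\<^esub> q \<otimes>\<^bsub>P\<^esub> f l) < residual_size (f k)"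
      proof (cases "r \<le> s")
        case True
        then obtain q where "q \<in> carrier P"
            "residual_size (f j \<oplus>\<^bsub>P\<^esub> q \<otimes>\<^bsub>P\<^esub> f i) < residual_size (f j)"
          using exists_residual_reduction[OF fc[OF i(1)] r fc[OF j(1)] s] by auto
        then show ?thesis using i(1) j(1,2) by (intro exI[of _ j] exI[of _ i] exI[of _ q]) simp
      next
        case False
        then have "s \<le> r" by simp
        then obtain q where "q \<in> carrier P"
            "residual_size (f i \<oplus>\<^bsub>P\<^esub> q \<otimes>\<^bsub>P\<^esub> f j) < residual_size (f i)"
          using exists_residual_reduction[OF fc[OF j(1)] s fc[OF i(1)] r] by auto
        then show ?thesis using i(1) j(1,2) by (intro exI[of _ i] exI[of _ j] exI[of _ q]) simp
      qed
      then obtain k l q where kl: "k < n" "l < n" "k \<noteq> l" and q: "q \<in> carrier P"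
        and red: "residual_size (f k \<oplus>\<^bsub>P\<^esub> q \<otimes>\<^bsub>P\<^esub> f l) < residual_size (f k)" by blast
      let ?f = "f(k := f k \<oplus>\<^bsub>P\<^esub> q \<otimes>\<^bsub>P\<^esub> f l)"
      have "(\<Sum>i<n. residual_size (?f i)) < (\<Sum>i<n. residual_size (f i))"
        by (rule sum_strict_mono_ex1) (use red kl in auto)
      moreover have "unimodular_row P n ?f"
        by (rule P.unimodular_add_multiple[OF less.prems q kl])
      ultimately have "has_free_kernel P n ?f" by (rule less.hyps)
      then show ?thesis
        by (rule P.has_free_kernel_add_multiple[rotated 5]) (use fc q kl in auto)
    qed
  qed
qed

end

text \<open>Over the zero ring every entry of a row equals \<open>1\<close>.\<close>

lemma (in UP_cring) hermite_ring_UP_trivial: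
  assumes "\<one> = \<zero>"
  shows "hermite_ring TYPE('m) P"
proof (rule P.hermite_ring_of_free_kernels)
  fix n f assume "unimodular_row P n f"
  then have f: "f \<in> {..<n} \<rightarrow> carrier P" by (simp add: unimodular_row_def)
  have eq: "p = q" if "p \<in> carrier P" "q \<in> carrier P" for p q
  proof (rule up_eqI[OF _ that])
    have "a = \<zero>" if "a \<in> carrier R" for a using that assms by (metis R.l_one R.l_null)
    then show "coeff P p n = coeff P q n" for n using that coeff_closed by metis
  qed
  show "has_free_kernel P n f"
  proof (cases n)
    case 0
    then show ?thesis using P.has_free_kernel_0 by simp
  next
    case (Suc m)
    then have "f m = \<one>\<^bsub>P\<^esub>" using f by (intro eq) auto
    then show ?thesis using P.has_free_kernel_unit[OF f] Suc by auto
  qed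
qed

theorem theorem3p2:
  fixes V :: "('a, 'k) ring_scheme"
  assumes "valuation_ring V"
  shows "hermite_ring TYPE('m) (UP V)"
proof -
  have "cring V" and total: "\<And>a b. a \<in> carrier V \<Longrightarrow> b \<in> carrier V \<Longrightarrow>
      a divides\<^bsub>V\<^esub> b \<or> b divides\<^bsub>V\<^esub> a"
    using assms by (auto simp: valuation_ring_iff_divides)
  interpret V: cring V by fact
  interpret UP_cring V "UP V" by unfold_locales
  show ?thesis
  proof (cases "\<one>\<^bsub>V\<^esub> = \<zero>\<^bsub>V\<^esub>")
    case True
    then show ?thesis by (rule hermite_ring_UP_trivial)
  next
    case False
    interpret valuation_UP V "UP V" by unfold_locales (use total False in auto)
    show ?thesis
      using unimodular_row_has_free_kernel by (rule P.hermite_ring_of_free_kernels)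
  qed
qed

end
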